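(* For each positive integer $n$ let $X_n$ be the number of permutations needed for the shuffling-and-merging process started from $[n]$ to end, and let $\mu_n=\mathbf{E}[X_n]$. For every integer $m\ge 2$, as $n\to+\infty$, $$\mathbf{E}\big[(X_n-\mu_n)^m\big]=\begin{cases}(2M-1)!!\cdot n^M+O(n^{M-1}\log n), & \text{if } m=2M,\\[2pt] \tfrac{2}{3}M(2M+1)!!\cdot n^M+O(n^{M-1}\log n), & \text{if } m=2M+1,\end{cases}$$ where the implied constants depend only on $m$.
   Context: The process. For a positive integer $n$, take a uniformly random permutation $\tau=(\tau(1),\ldots,\tau(n))$ of $[n]=\{1,2,\ldots,n\}$. A block of $\tau$ is a maximal sequence of (increasing) consecutive integers $a,a+1,\ldots,a+r$ ($r\ge 0$) that appear, in this order, in adjacent positions of $\tau$. For example, the blocks of $(1,7,5,6,8,10,9,2,3,4)$ are $(1),(7),(5,6),(8),(10),(9),(2,3,4)$. Each block is merged into its first integer, and after all the merges the elements of the new set are relabeled from $1$ to the current number of elements, giving $[k]$ where $k$ is the number of blocks. One then takes a new, independent, uniformly random permutation of $[k]$, merges again, and so on, until only one integer is left. $X_n$ is the number of permutations used until the process ends; by convention $X_1=0$. Equivalently, for $n\ge 2$, $X_n$ has the law of $1+\widetilde X_{Y_n}$, where $Y_n$ is the number of blocks in a uniformly random permutation of $[n]$ and the $\widetilde X_k$ ($1\le k\le n$) are independent of $Y_n$ and of each other, with $\widetilde X_k$ distributed as $X_k$. Double factorial: $n!!:=n(n-2)(n-4)\cdots$ (product of the positive terms). $f(n)=O(g(n))$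 means $|f(n)|\le C g(n)$ for a constant $C$ and all sufficiently large $n$. *)

theory Defs
  imports "HOL-Probability.Probability" "HOL-Library.Sublist"
begin

definition consecutive_run :: "nat list \<Rightarrow> nat list \<Rightarrow> bool" where
  "consecutive_run \<tau> b \<longleftrightarrow> (\<exists>a r. b = [a..<a + r + 1]) \<and> sublist b \<tau>"

(* A permutation tau of [k] is the list [tau(1), ..., tau(k)].  Its entries are distinct, so a block
   is determined by its list of values, and maximality is with respect to being a contiguous part. *)
definition blocks :: "nat list \<Rightarrow> nat list set" where
  "blocks \<tau> = {b. consecutive_run \<tau> b \<and>
                   (\<forall>b'. consecutive_run \<tau> b' \<and> sublist b b' \<longrightarrow> b' = b)}"

(* Sample point omega: omega t k is the permutation of [k] that is used as permutation number t + 1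
   if k integers are left at that moment.  All omega t k are independent, omega t k being uniform on
   the permutations of [k]; so the permutation used at each step is, given the past, a new
   uniformly random permutation of the current set. *)
definition shuffle_space :: "(nat \<Rightarrow> nat \<Rightarrow> nat list) measure" where
  "shuffle_space =
     (\<Pi>\<^sub>M t\<in>UNIV. \<Pi>\<^sub>M k\<in>UNIV. measure_pmf (pmf_of_set (permutations_of_set {1..k})))"

(* Merging each block into its first integer and relabelling turns [k] into [j] with j the number
   of blocks, so the state of the process is the number of integers left. *)
primrec num_left :: "nat \<Rightarrow> (nat \<Rightarrow> nat \<Rightarrow> nat list) \<Rightarrow> nat \<Rightarrow> nat" where
  "num_left n \<omega> 0 = n"
| "num_left n \<omega> (Suc t) = card (blocks (\<omega> t (num_left n \<omega> t)))"

(* For n > 0 the process ends almost surely; on the null event where it does not, the value of the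
   LEAST operator is an unspecified constant. *)
definition num_perms :: "nat \<Rightarrow> (nat \<Rightarrow> nat \<Rightarrow> nat list) \<Rightarrow> nat" where
  "num_perms n \<omega> = (LEAST t. num_left n \<omega> t = 1)"

definition mean_num_perms :: "nat \<Rightarrow> real" where
  "mean_num_perms n = (\<integral>\<omega>. real (num_perms n \<omega>) \<partial>shuffle_space)"

definition central_moment :: "nat \<Rightarrow> nat \<Rightarrow> real" where
  "central_moment m n = (\<integral>\<omega>. (real (num_perms n \<omega>) - mean_num_perms n) ^ m \<partial>shuffle_space)"

fun double_fact :: "nat \<Rightarrow> nat" where
  "double_fact 0 = 1"
| "double_fact (Suc 0) = 1"
| "double_fact (Suc (Suc n)) = Suc (Suc n) * double_fact n"

end

theory Submission
  imports Defs "HOL-Real_Asymp.Real_Asymp"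
begin

text \<open>Let \<open>D\<close> be the number of integers lost in one step from \<open>[n]\<close>, i.e. the number of successions
  (\<open>i\<close> directly followed by \<open>i + 1\<close>) of a random permutation. Inserting \<open>n + 1\<close> into a permutation
  of \<open>[n]\<close> gives the exact factorial moments \<open>E (D choose r) = (1 - r / n) / r!\<close>, so \<open>D\<close> is
  close to a Poisson variable of mean 1.

  With \<open>\<epsilon> = 1 + \<mu>(n - D) - \<mu>(n)\<close>, which has mean 0, conditioning on the first step gives
  \<open>c m n = E (\<Sum>j\<le>m. (m choose j) * c j (n - D) * \<epsilon> ^ (m - j))\<close> for the central moments \<open>c m n\<close>.
  A recurrence \<open>g n = E (g (n - D)) + h n\<close> with small \<open>h\<close> forces the increments of \<open>g\<close> to be of
  the order of \<open>h\<close>, by a contraction argument. Applied to \<open>\<mu>(n) - n\<close>, where \<open>h n = 1 / n\<close>,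
  it shows \<open>\<epsilon> = 1 - D + O(1 / n)\<close>; applied inductively to \<open>c m n\<close> minus its leading term, it yields
  the claim.\<close>

section \<open>Blocks and successions\<close>

text \<open>A step lowers the state only by about 1, so a forcing of size \<open>1 / n\<close>
  accumulates to \<open>log n\<close> and one of size \<open>n ^ k\<close> to
  \<open>n ^ (k + 1)\<close>. Contraction is therefore available for the increments
  \<open>g n - g (n - 1)\<close>, not for the values, which are recovered by summation; the
  logarithm of the theorem is the sum of \<open>1 / k\<close> at the lowest level, carried upwards
  by the induction.

  The coefficients come from matching the drift, about \<open>M * n ^ (M - 1)\<close>, of
  \<open>n ^ M\<close> with the forcing. The Poisson limit gives mean 0 for \<epsilon>, 1 for its
  square, -1 for its cube and -1 for \<open>D\<close> times \<epsilon>, and only the moments of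
  orders \<open>m - 1\<close>, \<open>m - 2\<close>, \<open>m - 3\<close> are large enough to
  contribute.

  The obstacle is odd \<open>m\<close>: the moment of order \<open>m - 1\<close> has size
  \<open>n ^ M\<close>, while a forcing of size \<open>n ^ (M - 1)\<close> has to be computed, and
  even the error of that moment is far above what is permitted. Since \<epsilon> is centred, the
  value at \<open>n\<close> cancels and only the change from \<open>n\<close> to
  \<open>n - D\<close> is felt. Hence the induction carries bounds on the increments of the errors
  next to bounds on the errors.\<close>

fun successions :: "nat list \<Rightarrow> nat" where
  "successions [] = 0"
| "successions [x] = 0"
| "successions (x # y # zs) = of_bool (y = Suc x) + successions (y # zs)"

lemma successions_append:
  "successions (xs @ ys) = successions xs + successions ys +
     of_bool (xs \<noteq> [] \<and> ys \<noteq> [] \<and> hd ys = Suc (last xs))"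
proof (induction xs rule: successions.induct)
  case (2 x)
  then show ?case by (cases ys) auto
qed auto

lemma successions_eq_sum:
  "successions xs = (\<Sum>i<length xs - 1. of_bool (xs ! Suc i = Suc (xs ! i)))"
proof (induction xs rule: successions.induct)
  case (3 x y zs)
  then show ?case by (simp add: sum.lessThan_Suc_shift del: sum.lessThan_Suc)
qed auto

lemma successions_le: "successions xs \<le> length xs - 1"
  unfolding successions_eq_sum
  using sum_mono[of "{..<length xs - 1}" "\<lambda>i. of_bool (xs ! Suc i = Suc (xs ! i))" "\<lambda>_. 1::nat"]
  by simp

text \<open>The new maximum creates a succession only behind \<open>N\<close>, is never the start of
  one, and destroys the succession that straddles its slot, if there is one. The destroyed
  succession is added on the left to avoid subtraction on naturals.\<close>

lemma successions_insert:
  assumes "i \<le> length xs" "Suc N \<notin> set xs" "\<forall>x\<in>set xs. x \<le> N"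
  shows "successions (take i xs @ Suc N # drop i xs)
           + of_bool (0 < i \<and> i < length xs \<and> xs ! i = Suc (xs ! (i - 1)))
         = successions xs + of_bool (0 < i \<and> xs ! (i - 1) = N)"
proof -
  have split: "successions xs = successions (take i xs) + successions (drop i xs)
      + of_bool (0 < i \<and> i < length xs \<and> xs ! i = Suc (xs ! (i - 1)))"
    using successions_append[of "take i xs" "drop i xs"] assms(1)
    by (auto simp: hd_drop_conv_nth last_conv_nth min_def simp flip: length_greater_0_conv)
  have "successions (Suc N # drop i xs) = successions (drop i xs)"
  proof (cases "drop i xs")
    case (Cons y ys)
    then have "y \<in> set xs" by (metis in_set_dropD list.set_intros(1))
    then show ?thesis using Cons assms(3) by force
  qed auto
  moreover have "successions (take i xs @ Suc N # drop i xs) =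
     successions (take i xs) + successions (Suc N # drop i xs) + of_bool (0 < i \<and> xs ! (i - 1) = N)"
    using assms(1)
    by (cases "xs = []") (auto simp: successions_append last_conv_nth min_def)
  ultimately show ?thesis using split by simp
qed

text \<open>The new maximum marks the cut, so both parts can be read off from the result;
  surjectivity then follows by counting, as \<open>fact N * (N + 1) = fact (N + 1)\<close>.\<close>

lemma permutations_of_set_insert_bij:
  fixes N :: nat
  shows "bij_betw (\<lambda>(xs, i). take i xs @ Suc N # drop i xs)
     (permutations_of_set {1..N} \<times> {..N}) (permutations_of_set {1..Suc N})"
proof -
  let ?f = "\<lambda>(xs, i). take i xs @ Suc N # drop i xs"
  let ?A = "permutations_of_set {1..N} \<times> {..N}"
  have inj: "inj_on ?f ?A"
  proof (rule inj_onI)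
    fix p q
    assume pq: "p \<in> ?A" "q \<in> ?A" "?f p = ?f q"
    obtain xs i ys j where [simp]: "p = (xs, i)" "q = (ys, j)" by (metis surj_pair)
    have xs: "xs \<in> permutations_of_set {1..N}" "i \<in> {..N}"
      and ys: "ys \<in> permutations_of_set {1..N}" "j \<in> {..N}"
      and eq: "take i xs @ Suc N # drop i xs = take j ys @ Suc N # drop j ys"
      using pq by auto
    have nin: "Suc N \<notin> set xs" "Suc N \<notin> set ys"
      using xs ys by (auto simp: permutations_of_set_def)
    have len: "length xs = N" "length ys = N"
      using xs ys by (auto simp: length_finite_permutations_of_set)
    have "Suc N \<notin> set (take i xs)" "Suc N \<notin> set (take j ys)"
      using nin by (meson in_set_takeD)+
    then have "take i xs = take j ys \<and> drop i xs = drop j ys"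
      using eq append_Cons_eq_iff[of "Suc N" "take i xs" "drop i xs" "take j ys" "drop j ys"] nin
        in_set_dropD[of "Suc N"] by blast
    then have "xs = ys" "min N i = min N j"
      using len by (metis append_take_drop_id, metis length_take)
    then show "p = q"
      using xs(2) ys(2) by simp
  qed
  have sub: "?f ` ?A \<subseteq> permutations_of_set {1..Suc N}"
  proof (rule image_subsetI)
    fix p
    assume p: "p \<in> ?A"
    obtain xs i where [simp]: "p = (xs, i)" by (metis surj_pair)
    have xs: "xs \<in> permutations_of_set {1..N}" "i \<in> {..N}" using p by auto
    then have "set xs = {1..N}" "distinct xs" by (auto dest: permutations_of_setD)
    moreover have "set (take i xs) \<union> set (drop i xs) = set xs"
      by (metis append_take_drop_id set_append)
    moreover have "set (take i xs) \<inter> set (drop i xs) = {}"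
      using \<open>distinct xs\<close> by (simp add: set_take_disj_set_drop_if_distinct)
    moreover have "Suc N \<notin> set xs" using \<open>set xs = _\<close> by simp
    ultimately have "take i xs @ Suc N # drop i xs \<in> permutations_of_set {1..Suc N}"
      using \<open>distinct xs\<close> by (intro permutations_of_setI) (auto dest: in_set_takeD in_set_dropD)
    then show "?f p \<in> permutations_of_set {1..Suc N}" by simp
  qed
  have "card (?f ` ?A) = card (permutations_of_set {1..Suc N})"
    unfolding card_image[OF inj] by (simp add: card_cartesian_product)
  then have "?f ` ?A = permutations_of_set {1..Suc N}"
    using sub by (intro card_subset_eq) auto
  with inj show ?thesis by (simp add: bij_betw_def)
qed

text \<open>Passing from contiguous parts to a start position and a length lets maximality be
  discussed through indices.\<close>

lemma consecutive_run_iff: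
  "consecutive_run \<tau> b \<longleftrightarrow> (\<exists>i r. i + r < length \<tau> \<and> b = [\<tau> ! i..<\<tau> ! i + r + 1] \<and>
     (\<forall>j\<le>r. \<tau> ! (i + j) = \<tau> ! i + j))"
proof
  assume "consecutive_run \<tau> b"
  then obtain a r us vs where b: "b = [a..<a + r + 1]" "\<tau> = us @ b @ vs"
    unfolding consecutive_run_def sublist_def by blast
  have "\<tau> ! (length us + j) = a + j" if "j \<le> r" for j
    using that b by (simp add: nth_append del: upt_Suc)
  moreover from this[of 0] have "\<tau> ! length us = a" by simp
  moreover have "length us + r < length \<tau>" using b by simp
  ultimately show "\<exists>i r. i + r < length \<tau> \<and> b = [\<tau> ! i..<\<tau> ! i + r + 1] \<and>
     (\<forall>j\<le>r. \<tau> ! (i + j) = \<tau> ! i + j)"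
    using b(1) by (intro exI[of _ "length us"] exI[of _ r]) auto
next
  assume "\<exists>i r. i + r < length \<tau> \<and> b = [\<tau> ! i..<\<tau> ! i + r + 1] \<and>
     (\<forall>j\<le>r. \<tau> ! (i + j) = \<tau> ! i + j)"
  then obtain i r where r: "i + r < length \<tau>" "b = [\<tau> ! i..<\<tau> ! i + r + 1]"
     "\<And>j. j \<le> r \<Longrightarrow> \<tau> ! (i + j) = \<tau> ! i + j" by blast
  have "b = take (r + 1) (drop i \<tau>)"
    by (rule nth_equalityI) (use r in \<open>auto simp del: upt_Suc\<close>)
  then have "sublist b \<tau>"
    using sublist_order.order.trans[OF sublist_take sublist_drop] by blast
  then show "consecutive_run \<tau> b" using r(2) unfolding consecutive_run_def by blast
qed

lemma sublist_upt_iff: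
  assumes "a < b"
  shows "sublist [a..<b] [c..<d] \<longleftrightarrow> c \<le> a \<and> b \<le> d"
proof
  assume "sublist [a..<b] [c..<d]"
  then have "set [a..<b] \<subseteq> set [c..<d]" by (rule set_mono_sublist)
  then show "c \<le> a \<and> b \<le> d" using assms by (auto simp: ivl_subset)
next
  assume "c \<le> a \<and> b \<le> d"
  then have "[c..<d] = [c..<a] @ [a..<b] @ [b..<d]"
    using assms by (metis le_add_diff_inverse less_imp_le_nat order_trans upt_add_eq_append)
  then show "sublist [a..<b] [c..<d]" unfolding sublist_def by blast
qed

text \<open>A block is determined by its head, and the heads are exactly the entries not directly
  preceded by their predecessor. The remaining positions are the ends of successions.\<close>

lemma card_blocks:
  assumes "distinct \<tau>"
  shows "card (blocks \<tau>) + successions \<tau> = length \<tau>"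
proof -
  define I where "I = {i. i < length \<tau> \<and> (i = 0 \<or> \<tau> ! i \<noteq> Suc (\<tau> ! (i - 1)))}"
  define run where "run i r \<longleftrightarrow> i + r < length \<tau> \<and> (\<forall>j\<le>r. \<tau> ! (i + j) = \<tau> ! i + j)" for i r
  define U where "U i r = [\<tau> ! i..<\<tau> ! i + r + 1]" for i r
  have cr: "consecutive_run \<tau> b \<longleftrightarrow> (\<exists>i r. run i r \<and> b = U i r)" for b
    unfolding consecutive_run_iff run_def U_def by blast
  have idx: "i = j" if "\<tau> ! i = \<tau> ! j" "i < length \<tau>" "j < length \<tau>" for i j
    using that assms nth_eq_iff_index_eq by blast
  have hdU: "hd (U i r) = \<tau> ! i" for i r by (simp add: U_def hd_conv_nth del: upt_Suc)
  have subU: "sublist (U i r) (U i' r') \<longleftrightarrow> \<tau> ! i' \<le> \<tau> ! i \<and> \<tau> ! i + r \<le> \<tau> ! i' + r'" for i r i' r'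
    unfolding U_def by (subst sublist_upt_iff) auto
  have inj: "inj_on hd (blocks \<tau>)"
  proof (rule inj_onI)
    fix b b' assume b: "b \<in> blocks \<tau>" "b' \<in> blocks \<tau>" "hd b = hd b'"
    then obtain i r i' r' where r: "run i r" "b = U i r" "run i' r'" "b' = U i' r'"
      unfolding blocks_def cr by blast
    then have ii: "i = i'" using b(3) hdU idx by (auto simp: run_def)
    have "sublist b b' \<or> sublist b' b" unfolding r(2,4) subU ii by auto
    then show "b = b'" using b(1,2) unfolding blocks_def by blast
  qed
  have im: "hd ` blocks \<tau> = (!) \<tau> ` I"
  proof
    show "hd ` blocks \<tau> \<subseteq> (!) \<tau> ` I"
    proof (rule image_subsetI)
      fix b assume b: "b \<in> blocks \<tau>"
      then obtain i r where r: "run i r" "b = U i r" unfolding blocks_def cr by blast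
      have "i \<in> I"
      proof (rule ccontr)
        assume "i \<notin> I"
        then obtain k where k: "i = Suc k" "\<tau> ! i = Suc (\<tau> ! k)"
          using r(1) unfolding I_def run_def by (cases i) auto
        \<comment> \<open>If the entry in front of \<open>i\<close> were the predecessor, the run
          could be extended to the left, against maximality of \<open>b\<close>.\<close>
        have "run k (Suc r)"
          unfolding run_def
        proof (intro conjI allI impI)
          fix j assume j: "j \<le> Suc r"
          show "\<tau> ! (k + j) = \<tau> ! k + j"
          proof (cases j)
            case (Suc l)
            then have "\<tau> ! (i + l) = \<tau> ! i + l" using j r(1) by (auto simp: run_def)
            then show ?thesis using k Suc by simp
          qed simp
        qed (use r(1) k in \<open>auto simp: run_def\<close>)
        moreover have "sublist b (U k (Suc r))" unfolding r(2) subU using k by simp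
        ultimately have "U k (Suc r) = b" using b unfolding blocks_def cr by blast
        then show False using arg_cong[of "U k (Suc r)" b length] r(2) by (simp add: U_def)
      qed
      then show "hd b \<in> (!) \<tau> ` I" using r(2) hdU by auto
    qed
    show "(!) \<tau> ` I \<subseteq> hd ` blocks \<tau>"
    proof (rule image_subsetI)
      fix i assume i: "i \<in> I"
      define r where "r = Max {r. run i r}"
      have fin: "finite {r. run i r}"
        by (rule finite_subset[of _ "{..length \<tau>}"]) (auto simp: run_def)
      have "run i 0" using i by (auto simp: run_def I_def)
      then have "r \<in> {r. run i r}" unfolding r_def using fin by (intro Max_in) auto
      then have r: "run i r" by simp
      have rmax: "r' \<le> r" if "run i r'" for r'
        unfolding r_def using fin that by (intro Max_ge) auto
      have "U i r \<in> blocks \<tau>"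
        unfolding blocks_def cr
      proof (intro CollectI conjI allI impI)
        show "\<exists>ia ra. run ia ra \<and> U i r = U ia ra" using r by blast
        fix b' assume "(\<exists>i r. run i r \<and> b' = U i r) \<and> sublist (U i r) b'"
        then obtain i' r' where r': "run i' r'" "b' = U i' r'" "\<tau> ! i' \<le> \<tau> ! i"
            "\<tau> ! i + r \<le> \<tau> ! i' + r'"
          by (auto simp: subU)
        define j where "j = \<tau> ! i - \<tau> ! i'"
        have j: "j \<le> r'" "i' + j < length \<tau>"
          using r' by (auto simp: j_def run_def)
        have j': "\<tau> ! (i' + j) = \<tau> ! i"
          using r'(1,3) j(1) unfolding run_def j_def by auto
        have ij: "i = i' + j"
          by (rule idx) (use j j' i in \<open>auto simp: I_def\<close>)
        \<comment> \<open>Any run containing the one from \<open>i\<close> starts at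
          \<open>i\<close>: otherwise the entry at \<open>i\<close> would follow its predecessor,
          which the choice of \<open>I\<close> excludes.\<close>
        have "j = 0"
        proof (rule ccontr)
          assume "j \<noteq> 0"
          then obtain l where l: "j = Suc l" by (cases j) auto
          have "\<tau> ! (i' + l) = \<tau> ! i' + l" "\<tau> ! (i' + Suc l) = \<tau> ! i' + Suc l"
            using r'(1) j(1) l unfolding run_def by auto
          then show False using i ij l by (simp add: I_def)
        qed
        then show "b' = U i r" using ij r' rmax[of r'] by auto
      qed
      then show "\<tau> ! i \<in> hd ` blocks \<tau>" using hdU[of i r] by force
    qed
  qed
  have "card (blocks \<tau>) = card I"
    using card_image[OF inj] im by (metis (no_types, lifting) I_def assms card_image inj_on_nth mem_Collect_eq)
  moreover have "card I + successions \<tau> = length \<tau>"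
  proof -
    let ?J = "{i. i < length \<tau> - 1 \<and> \<tau> ! Suc i = Suc (\<tau> ! i)}"
    have "successions \<tau> = card ?J"
      unfolding successions_eq_sum by (simp add: of_bool_def sum.If_cases Int_def)
    also have "\<dots> = card (Suc ` ?J)" by (simp add: card_image)
    also have "Suc ` ?J = {..<length \<tau>} - I"
      by (fastforce simp: I_def image_iff gr0_conv_Suc)
    also have "card \<dots> = length \<tau> - card I"
      by (subst card_Diff_subset) (auto simp: I_def)
    finally have "successions \<tau> = length \<tau> - card I" .
    moreover have I: "I \<subseteq> {..<length \<tau>}" by (auto simp: I_def)
    ultimately show ?thesis
      using card_mono[of "{..<length \<tau>}" I] I by simp
  qed
  ultimately show ?thesis by simp
qed

section \<open>Factorial moments of the number of successions\<close>

text \<open>\<open>Ed n f\<close> is the expectation of \<open>f(n - Y_n)\<close>.\<close>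

definition Ed :: "nat \<Rightarrow> (nat \<Rightarrow> real) \<Rightarrow> real" where
  "Ed n f = (\<Sum>\<tau>\<in>permutations_of_set {1..n}. f (successions \<tau>)) / fact n"

text \<open>Of the \<open>n + 1\<close> slots, one (behind \<open>n\<close>) creates a succession,
  \<open>d\<close> destroy one and the others are neutral. The result is the generator of the
  immigration-death chain whose stationary law is Poisson of mean 1.\<close>

lemma sum_successions_insert:
  fixes f :: "nat \<Rightarrow> real"
  assumes xs: "xs \<in> permutations_of_set {1..n}" and n: "n \<ge> 1"
  defines "d \<equiv> successions xs"
  shows "(\<Sum>i\<le>n. f (successions (take i xs @ Suc n # drop i xs))) =
      (real n + 1) * f d + (f (Suc d) - f d) + real d * (f (d - 1) - f d)"
proof -
  have S: "set xs = {1..n}" "distinct xs" using permutations_of_setD[OF xs] by blast+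
  have len: "length xs = n" using length_finite_permutations_of_set[OF xs] by simp
  define J where "J i \<longleftrightarrow> 0 < i \<and> i < n \<and> xs ! i = Suc (xs ! (i - 1))" for i
  obtain k where k: "k < n" "xs ! k = n"
  proof -
    have "n \<in> set xs" using S(1) n by simp
    then show ?thesis using that len by (auto simp: in_set_conv_nth)
  qed
  have last: "0 < i \<and> xs ! (i - 1) = n \<longleftrightarrow> i = Suc k" if "i \<le> n" for i
  proof
    assume i: "0 < i \<and> xs ! (i - 1) = n"
    then have "i - 1 = k"
      using nth_eq_iff_index_eq[OF S(2), of "i - 1" k] that k len by linarith
    then show "i = Suc k" using i by linarith
  next
    assume "i = Suc k"
    then show "0 < i \<and> xs ! (i - 1) = n" using k(2) by simp
  qed
  \<comment> \<open>The slot behind \<open>n\<close> breaks nothing, because \<open>n + 1\<close> is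
    not yet present; so creation and destruction never occur together.\<close>
  have nJ: "\<not> J (Suc k)"
  proof
    assume "J (Suc k)"
    then have J1: "Suc k < n" "xs ! Suc k = Suc n" unfolding J_def using k(2) by simp_all
    then have "xs ! Suc k \<in> set xs" by (intro nth_mem) (simp add: len)
    then show False using S(1) J1(2) by simp
  qed
  have ins: "successions (take i xs @ Suc n # drop i xs) + of_bool (J i) = d + of_bool (i = Suc k)"
    if "i \<le> n" for i
  proof -
    have "i \<le> length xs" "Suc n \<notin> set xs" "\<forall>x\<in>set xs. x \<le> n"
      unfolding len S(1) using that by auto
    from successions_insert[OF this] show ?thesis
      unfolding last[OF that] len J_def d_def .
  qed
  have eq: "f (successions (take i xs @ Suc n # drop i xs)) =
      f d + of_bool (i = Suc k) * (f (Suc d) - f d) + of_bool (J i) * (f (d - 1) - f d)"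
    if "i \<le> n" for i
  proof -
    consider "i = Suc k" "\<not> J i" | "i \<noteq> Suc k" "\<not> J i" | "i \<noteq> Suc k" "J i" using nJ by blast
    then show ?thesis
    proof cases
      case 3
      then have "successions (take i xs @ Suc n # drop i xs) = d - 1" using ins[OF that] by simp
      then show ?thesis using 3 by simp
    qed (use ins[OF that] in auto)
  qed
  have "(\<Sum>i\<le>n. of_bool (J i) :: real) = (\<Sum>i<n - 1. of_bool (xs ! Suc i = Suc (xs ! i)))"
  proof -
    have "(\<Sum>i\<le>n. of_bool (J i) :: real) = (\<Sum>i\<in>Suc ` {..<n-1}. of_bool (J i))"
      by (rule sum.mono_neutral_right) (auto simp: J_def image_iff gr0_conv_Suc)
    also have "\<dots> = (\<Sum>i<n - 1. of_bool (xs ! Suc i = Suc (xs ! i)))"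
      by (subst sum.reindex) (auto simp: J_def less_diff_conv simp del: sum_of_bool_eq intro!: sum.cong)
    finally show ?thesis .
  qed
  also have "\<dots> = real d"
    by (simp add: d_def successions_eq_sum len)
  finally have J: "(\<Sum>i\<le>n. of_bool (J i) :: real) = real d" .
  have K: "(\<Sum>i\<le>n. of_bool (i = Suc k) :: real) = 1"
    using k(1) by (simp add: of_bool_def)
  have "(\<Sum>i\<le>n. f (successions (take i xs @ Suc n # drop i xs))) =
     (\<Sum>i\<le>n. f d + of_bool (i = Suc k) * (f (Suc d) - f d) + of_bool (J i) * (f (d - 1) - f d))"
    by (rule sum.cong) (use eq in auto)
  also have "\<dots> = (real n + 1) * f d + (f (Suc d) - f d) + real d * (f (d - 1) - f d)"
    unfolding sum.distrib sum_distrib_right[symmetric] J K by (simp add: algebra_simps)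
  finally show ?thesis .
qed

lemma Ed_Suc:
  assumes "n \<ge> 1"
  shows "Ed (Suc n) f =
    Ed n (\<lambda>d. f d + ((f (Suc d) - f d) + real d * (f (d - 1) - f d)) / (real n + 1))"
proof -
  have "(\<Sum>\<tau>\<in>permutations_of_set {1..Suc n}. f (successions \<tau>)) =
     (\<Sum>(xs, i)\<in>permutations_of_set {1..n} \<times> {..n}. f (successions (take i xs @ Suc n # drop i xs)))"
    by (subst sum.reindex_bij_betw[OF permutations_of_set_insert_bij, symmetric])
       (auto intro!: sum.cong)
  also have "\<dots> = (\<Sum>xs\<in>permutations_of_set {1..n}. \<Sum>i\<le>n. f (successions (take i xs @ Suc n # drop i xs)))"
    by (subst sum.cartesian_product) auto
  also have "\<dots> = (\<Sum>xs\<in>permutations_of_set {1..n}. let d = successions xs in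
       (real n + 1) * f d + (f (Suc d) - f d) + real d * (f (d - 1) - f d))"
    by (rule sum.cong) (simp_all add: sum_successions_insert[OF _ assms] Let_def)
  also have "\<dots> = (real n + 1) * (\<Sum>xs\<in>permutations_of_set {1..n}. let d = successions xs in
       f d + ((f (Suc d) - f d) + real d * (f (d - 1) - f d)) / (real n + 1))"
    unfolding sum_distrib_left by (rule sum.cong) (auto simp: Let_def field_simps)
  finally have *: "(\<Sum>\<tau>\<in>permutations_of_set {1..Suc n}. f (successions \<tau>)) = \<dots>" .
  have "fact (Suc n) = (real n + 1) * fact n" by simp
  moreover have "real n + 1 \<noteq> 0" by simp
  ultimately show ?thesis
    unfolding Ed_def * Let_def by (simp only: mult_divide_mult_cancel_left simp_thms if_False)
qed

lemma Ed_add: "Ed n (\<lambda>d. f d + g d) = Ed n f + Ed n g"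
  by (simp add: Ed_def sum.distrib add_divide_distrib)

lemma Ed_diff: "Ed n (\<lambda>d. f d - g d) = Ed n f - Ed n g"
  by (simp add: Ed_def sum_subtractf diff_divide_distrib)

lemma Ed_cmult: "Ed n (\<lambda>d. c * f d) = c * Ed n f"
  by (simp add: Ed_def sum_distrib_left)

lemma Ed_multc: "Ed n (\<lambda>d. f d * c) = Ed n f * c"
  by (simp add: Ed_def sum_distrib_right)

lemma Ed_sum: "Ed n (\<lambda>d. \<Sum>i\<in>A. f i d) = (\<Sum>i\<in>A. Ed n (f i))"
  unfolding Ed_def by (subst sum.swap) (simp add: sum_divide_distrib)

lemma Ed_const [simp]: "Ed n (\<lambda>d. c) = c"
  by (simp add: Ed_def)

lemma successions_less:
  assumes "n \<ge> 1" "\<tau> \<in> permutations_of_set {1..n}"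
  shows "successions \<tau> < n"
  using successions_le[of \<tau>] assms by (auto simp: length_finite_permutations_of_set)

lemma Ed_mono:
  assumes "n \<ge> 1" "\<And>d. d < n \<Longrightarrow> f d \<le> g d"
  shows "Ed n f \<le> Ed n g"
  unfolding Ed_def using assms successions_less by (intro divide_right_mono sum_mono) auto

lemma Ed_cong:
  assumes "n \<ge> 1" "\<And>d. d < n \<Longrightarrow> f d = g d"
  shows "Ed n f = Ed n g"
  using assms by (intro antisym Ed_mono) auto

lemma Ed_abs: "\<bar>Ed n f\<bar> \<le> Ed n (\<lambda>d. \<bar>f d\<bar>)"
  unfolding Ed_def by (simp add: abs_divide divide_right_mono sum_abs)

text \<open>The insertion generator sends \<open>d choose r\<close> to
  \<open>(d choose (r - 1)) - r * (d choose r)\<close>. Binomial coefficients therefore satisfy a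
  closed triangular recursion in \<open>n\<close>.\<close>

lemma Ed_binomial:
  assumes "r \<le> n" "n \<ge> 1"
  shows "Ed n (\<lambda>d. real (d choose r)) = (1 - real r / real n) / fact r"
  using assms(2,1)
proof (induction n arbitrary: r rule: dec_induct)
  case base
  from base have "r = 0 \<or> r = 1" by auto
  then show ?case by (auto simp: Ed_def)
next
  case (step n)
  show ?case
  proof (cases r)
    case 0
    then show ?thesis by simp
  next
    case (Suc s)
    have pt: "real (d choose r) + ((real (Suc d choose r) - real (d choose r)) +
       real d * (real (d - 1 choose r) - real (d choose r))) / (real n + 1)
      = real (d choose r) * (1 - real r / (real n + 1)) + real (d choose s) * (1 / (real n + 1))" for d
    proof -
      have 1: "real (Suc d choose r) - real (d choose r) = real (d choose s)"
        by (simp add: Suc)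
      have 2: "real d * (real (d - 1 choose r) - real (d choose r)) = - real r * real (d choose r)"
      proof (cases d)
        case (Suc e)
        have "real r * real (d choose r) = real d * real (e choose s)"
          using times_binomial_minus1_eq[of r d] \<open>r = Suc s\<close> Suc
          by (metis Suc_eq_plus1 diff_Suc_1 of_nat_mult zero_less_Suc)
        then show ?thesis using Suc \<open>r = Suc s\<close> by (simp add: algebra_simps)
      qed (simp add: Suc)
      show ?thesis unfolding 1 2 by (simp add: add_divide_distrib diff_divide_distrib algebra_simps)
    qed
    have E: "Ed (Suc n) (\<lambda>d. real (d choose r)) =
        Ed n (\<lambda>d. real (d choose r)) * (1 - real r / (real n + 1))
          + Ed n (\<lambda>d. real (d choose s)) * (1 / (real n + 1))"
      unfolding Ed_Suc[OF step(1)] pt Ed_add Ed_multc ..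
    have s: "Ed n (\<lambda>d. real (d choose s)) = (1 - real s / real n) / fact s"
      using step.IH[of s] step.prems Suc by simp
    show ?thesis
    proof (cases "r \<le> n")
      case True
      have n0: "real n > 0" using step(1) by simp
      have f: "fact r = real r * fact s" by (simp add: Suc)
      have r0: "real r > 0" by (simp add: Suc)
      have rs: "real s = real r - 1" by (simp add: Suc)
      show ?thesis unfolding E s step.IH[OF True] f rs using n0 r0
        by (simp add: divide_simps) (simp add: algebra_simps)
    next
      case False
      \<comment> \<open>At the boundary the induction hypothesis does not reach order
        \<open>r\<close>, but fewer than \<open>n\<close> successions are possible, so both sides
        vanish.\<close>
      then have r: "r = Suc n" "s = n" using step.prems Suc by auto
      have "Ed n (\<lambda>d. real (d choose r)) = Ed n (\<lambda>d. 0)"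
        using r step(1) by (intro Ed_cong) auto
      then show ?thesis unfolding E s using r step(1) by simp
    qed
  qed
qed

section \<open>The first-step equations for the moments\<close>

definition perm_family :: "(nat \<Rightarrow> nat list) measure" where
  "perm_family = (\<Pi>\<^sub>M k\<in>UNIV. measure_pmf (pmf_of_set (permutations_of_set {1..k})))"

text \<open>Read along time, the space is an i.i.d. sequence of slices, each offering one
  permutation for every possible current size.\<close>

lemma shuffle_space_eq: "shuffle_space = (\<Pi>\<^sub>M t\<in>(UNIV::nat set). perm_family)"
  by (simp add: shuffle_space_def perm_family_def)

lemma product_prob_space_permutations:
  "product_prob_space (\<lambda>k::nat. measure_pmf (pmf_of_set (permutations_of_set {1..k})))"
  by standard

lemma prob_space_perm_family: "prob_space perm_family"
  unfolding perm_family_def by (rule prob_space_PiM) (rule prob_space_measure_pmf)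

interpretation perm_family: prob_space perm_family
  by (rule prob_space_perm_family)

lemma sequence_space_perm_family: "sequence_space perm_family"
  unfolding sequence_space_def product_prob_space_def product_prob_space_axioms_def product_sigma_finite_def
  by (simp add: perm_family.prob_space_axioms perm_family.sigma_finite_measure_axioms)

interpretation shuffle: prob_space shuffle_space
  unfolding shuffle_space_eq by (rule prob_space_PiM) (rule prob_space_perm_family)

interpretation pair: pair_sigma_finite perm_family shuffle_space
  by standard

text \<open>This is the Markov property in integrated form: prepending an independent slice does not
  change the law of the sequence.\<close>

lemma distr_case_nat_shuffle:
  "distr (perm_family \<Otimes>\<^sub>M shuffle_space) shuffle_space (\<lambda>(s, \<omega>). case_nat s \<omega>) = shuffle_space"
  unfolding shuffle_space_eq by (rule sequence_space.PiM_iter[OF sequence_space_perm_family])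

lemma measurable_perm_family [measurable]:
  "(\<lambda>s. f (s k)) \<in> perm_family \<rightarrow>\<^sub>M count_space UNIV"
proof -
  have "(\<lambda>s. s k) \<in> perm_family \<rightarrow>\<^sub>M measure_pmf (pmf_of_set (permutations_of_set {1..k}))"
    unfolding perm_family_def by (rule measurable_component_singleton) simp
  then show ?thesis by (rule measurable_compose) simp
qed

lemma measurable_shuffle [measurable]:
  "(\<lambda>\<omega>. f (\<omega> t k)) \<in> shuffle_space \<rightarrow>\<^sub>M count_space UNIV"
proof -
  have "(\<lambda>\<omega>. \<omega> t) \<in> shuffle_space \<rightarrow>\<^sub>M perm_family"
    unfolding shuffle_space_eq by (rule measurable_component_singleton) simp
  then show ?thesis by (rule measurable_compose) measurable
qed

text \<open>The next permutation is selected by a random index, the current state; since there are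
  countably many states, the selection is measurable.\<close>

lemma measurable_num_left [measurable]:
  "(\<lambda>\<omega>. num_left n \<omega> t) \<in> shuffle_space \<rightarrow>\<^sub>M count_space UNIV"
proof (induction t)
  case (Suc t)
  show ?case
    unfolding num_left.simps
    by (rule measurable_compose_countable[where f = "\<lambda>k \<omega>. card (blocks (\<omega> t k))", OF _ Suc]) measurable
qed simp

lemma measurable_num_perms [measurable]:
  "num_perms n \<in> shuffle_space \<rightarrow>\<^sub>M count_space UNIV"
  unfolding num_perms_def[abs_def] by measurable

lemma num_left_case_nat:
  "num_left n (case_nat s \<omega>) (Suc t) = num_left (card (blocks (s n))) \<omega> t"
  by (induction t) auto

lemma measurable_perm_family_component [measurable]:
  "(\<lambda>s. s n) \<in> perm_family \<rightarrow>\<^sub>M measure_pmf (pmf_of_set (permutations_of_set {1..n}))"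
  unfolding perm_family_def by (rule measurable_component_singleton) simp

lemma distr_perm_family:
  "distr perm_family (measure_pmf (pmf_of_set (permutations_of_set {1..n}))) (\<lambda>s. s n)
     = measure_pmf (pmf_of_set (permutations_of_set {1..n}))"
  unfolding perm_family_def
  by (rule product_prob_space.PiM_component[OF product_prob_space_permutations]) simp

lemma nn_integral_perm_family:
  "(\<integral>\<^sup>+s. h (s n) \<partial>perm_family) = (\<Sum>\<tau>\<in>permutations_of_set {1..n}. h \<tau>) / fact n"
proof -
  have "(\<integral>\<^sup>+s. h (s n) \<partial>perm_family) =
      (\<integral>\<^sup>+\<tau>. h \<tau> \<partial>measure_pmf (pmf_of_set (permutations_of_set {1..n})))"
    by (rule nn_integral_distr[OF measurable_perm_family_component, unfolded distr_perm_family, symmetric]) simp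
  also have "\<dots> = (\<Sum>\<tau>\<in>permutations_of_set {1..n}. h \<tau>) / fact n"
    by (subst nn_integral_pmf_of_set) (auto simp: ennreal_of_nat_eq_real_of_nat ennreal_fact)
  finally show ?thesis .
qed

lemma integral_perm_family:
  fixes h :: "nat list \<Rightarrow> real"
  shows "(\<integral>s. h (s n) \<partial>perm_family) = (\<Sum>\<tau>\<in>permutations_of_set {1..n}. h \<tau>) / fact n"
proof -
  have "(\<integral>s. h (s n) \<partial>perm_family) =
      (\<integral>\<tau>. h \<tau> \<partial>measure_pmf (pmf_of_set (permutations_of_set {1..n})))"
    by (rule integral_distr[OF measurable_perm_family_component, unfolded distr_perm_family, symmetric]) simp
  also have "\<dots> = (\<Sum>\<tau>\<in>permutations_of_set {1..n}. h \<tau>) / fact n"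
    by (subst integral_pmf_of_set) auto
  finally show ?thesis .
qed

lemma card_blocks_permutation:
  assumes "\<tau> \<in> permutations_of_set {1..n}"
  shows "card (blocks \<tau>) = n - successions \<tau>"
  using card_blocks[OF permutations_of_setD(2)[OF assms]] assms
  by (simp add: length_finite_permutations_of_set)

lemma integral_perm_family_blocks:
  fixes h :: "nat \<Rightarrow> real"
  shows "(\<integral>s. h (card (blocks (s n))) \<partial>perm_family) = Ed n (\<lambda>d. h (n - d))"
  unfolding integral_perm_family[of "\<lambda>\<tau>. h (card (blocks \<tau>))"] Ed_def
  by (simp add: card_blocks_permutation)

text \<open>The Tonelli version asks for no integrability, so it can serve in the termination bound
  from which integrability is later derived.\<close>

lemma nn_integral_shuffle_step:
  assumes [measurable]: "f \<in> borel_measurable shuffle_space"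
  shows "(\<integral>\<^sup>+\<omega>. f \<omega> \<partial>shuffle_space) =
     (\<integral>\<^sup>+s. (\<integral>\<^sup>+\<omega>. f (case_nat s \<omega>) \<partial>shuffle_space) \<partial>perm_family)"
proof -
  have [measurable]: "(\<lambda>(s, \<omega>). case_nat s \<omega>) \<in> perm_family \<Otimes>\<^sub>M shuffle_space \<rightarrow>\<^sub>M shuffle_space"
    unfolding shuffle_space_eq by measurable
  have "(\<integral>\<^sup>+\<omega>. f \<omega> \<partial>shuffle_space) =
     (\<integral>\<^sup>+\<omega>. f \<omega> \<partial>distr (perm_family \<Otimes>\<^sub>M shuffle_space) shuffle_space (\<lambda>(s, \<omega>). case_nat s \<omega>))"
    unfolding distr_case_nat_shuffle ..
  also have "\<dots> = (\<integral>\<^sup>+x. f (case_nat (fst x) (snd x)) \<partial>(perm_family \<Otimes>\<^sub>M shuffle_space))"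
    by (subst nn_integral_distr) (auto simp: case_prod_beta')
  also have "\<dots> = (\<integral>\<^sup>+s. (\<integral>\<^sup>+\<omega>. f (case_nat s \<omega>) \<partial>shuffle_space) \<partial>perm_family)"
    by (subst shuffle.nn_integral_fst[symmetric]) (auto simp: case_prod_beta')
  finally show ?thesis .
qed

lemma measurable_case_nat_shuffle [measurable]:
  "(\<lambda>(s, \<omega>). case_nat s \<omega>) \<in> perm_family \<Otimes>\<^sub>M shuffle_space \<rightarrow>\<^sub>M shuffle_space"
  unfolding shuffle_space_eq by measurable

lemma integral_shuffle_step:
  fixes f :: "(nat \<Rightarrow> nat \<Rightarrow> nat list) \<Rightarrow> real"
  assumes "integrable shuffle_space f"
  shows "(\<integral>\<omega>. f \<omega> \<partial>shuffle_space) =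
     (\<integral>s. (\<integral>\<omega>. f (case_nat s \<omega>) \<partial>shuffle_space) \<partial>perm_family)"
proof -
  have m [measurable]: "f \<in> borel_measurable shuffle_space" using assms by auto
  have "integrable (distr (perm_family \<Otimes>\<^sub>M shuffle_space) shuffle_space (\<lambda>(s, \<omega>). case_nat s \<omega>)) f"
    unfolding distr_case_nat_shuffle by (rule assms)
  then have int: "integrable (perm_family \<Otimes>\<^sub>M shuffle_space) (\<lambda>(s, \<omega>). f (case_nat s \<omega>))"
    by (subst (asm) integrable_distr_eq) (auto simp: case_prod_beta')
  have "(\<integral>\<omega>. f \<omega> \<partial>shuffle_space) =
     (\<integral>\<omega>. f \<omega> \<partial>distr (perm_family \<Otimes>\<^sub>M shuffle_space) shuffle_space (\<lambda>(s, \<omega>). case_nat s \<omega>))"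
    unfolding distr_case_nat_shuffle ..
  also have "\<dots> = (\<integral>x. f (case_nat (fst x) (snd x)) \<partial>(perm_family \<Otimes>\<^sub>M shuffle_space))"
    by (subst integral_distr) (auto simp: case_prod_beta')
  also have "\<dots> = (\<integral>s. (\<integral>\<omega>. f (case_nat s \<omega>) \<partial>shuffle_space) \<partial>perm_family)"
    using pair.integral_fst[OF int] by (simp add: case_prod_beta')
  finally show ?thesis .
qed

section \<open>Almost sure termination and exponential moments\<close>

lemma nn_integral_num_left:
  assumes "1 \<le> n" "n \<le> N"
  shows "(\<integral>\<^sup>+\<omega>. ennreal (real (num_left n \<omega> t) - 1) \<partial>shuffle_space)
           \<le> ennreal ((1 - 1 / real N) ^ t * (real n - 1))"
  using assms
proof (induction t arbitrary: n)
  case 0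
  then show ?case by (simp add: shuffle.emeasure_space_1)
next
  case (Suc t)
  have N: "0 \<le> 1 - 1 / real N" using Suc.prems by simp
  have "(\<integral>\<^sup>+\<omega>. ennreal (real (num_left n \<omega> (Suc t)) - 1) \<partial>shuffle_space) =
    (\<integral>\<^sup>+s. (\<integral>\<^sup>+\<omega>. ennreal (real (num_left (card (blocks (s n))) \<omega> t) - 1) \<partial>shuffle_space) \<partial>perm_family)"
    by (subst nn_integral_shuffle_step, measurable) (simp only: num_left_case_nat)
  also have "\<dots> = (\<Sum>\<tau>\<in>permutations_of_set {1..n}.
      (\<integral>\<^sup>+\<omega>. ennreal (real (num_left (card (blocks \<tau>)) \<omega> t) - 1) \<partial>shuffle_space)) / fact n"
    by (rule nn_integral_perm_family)
  also have "\<dots> \<le> (\<Sum>\<tau>\<in>permutations_of_set {1..n}.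
      ennreal ((1 - 1 / real N) ^ t * (real (n - successions \<tau>) - 1))) / fact n"
  proof (intro divide_right_mono_ennreal sum_mono)
    fix \<tau> assume t: "\<tau> \<in> permutations_of_set {1..n}"
    have "1 \<le> n - successions \<tau>" using successions_less[OF Suc.prems(1) t] by simp
    moreover have "n - successions \<tau> \<le> N" using Suc.prems by simp
    ultimately show "(\<integral>\<^sup>+\<omega>. ennreal (real (num_left (card (blocks \<tau>)) \<omega> t) - 1) \<partial>shuffle_space)
      \<le> ennreal ((1 - 1 / real N) ^ t * (real (n - successions \<tau>) - 1))"
      unfolding card_blocks_permutation[OF t] by (rule Suc.IH)
  qed
  also have "\<dots> = ennreal (Ed n (\<lambda>d. (1 - 1 / real N) ^ t * (real (n - d) - 1)))"
  proof -
    have "0 \<le> (1 - 1 / real N) ^ t * (real (n - successions \<tau>) - 1)"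
      if "\<tau> \<in> permutations_of_set {1..n}" for \<tau>
      using successions_less[OF Suc.prems(1) that] N by (intro mult_nonneg_nonneg) auto
    then show ?thesis unfolding Ed_def
      by (simp add: sum_nonneg divide_ennreal flip: ennreal_fact)
  qed
  also have "Ed n (\<lambda>d. (1 - 1 / real N) ^ t * (real (n - d) - 1)) =
     Ed n (\<lambda>d. (1 - 1 / real N) ^ t * ((real n - 1) - real (d choose 1)))"
    using Suc.prems by (intro Ed_cong) auto
  \<comment> \<open>The mean loss \<open>1 - 1 / n\<close> equals \<open>(n - 1) / n\<close>, so the
    distance to the final state 1 shrinks in mean by exactly \<open>1 - 1 / n\<close>. The fixed
    \<open>N \<ge> n\<close> makes the factor uniform along the process, whose states only
    decrease.\<close>
  also have "\<dots> = (1 - 1 / real N) ^ t * ((1 - 1 / real n) * (real n - 1))"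
  proof -
    have "Ed n (\<lambda>d. (real n - 1) - real (d choose 1)) = (1 - 1 / real n) * (real n - 1)"
      unfolding Ed_diff Ed_const using Suc.prems Ed_binomial[of 1 n] by (simp add: field_simps)
    then show ?thesis unfolding Ed_cmult by simp
  qed
  also have "\<dots> \<le> (1 - 1 / real N) ^ t * ((1 - 1 / real N) * (real n - 1))"
    using Suc.prems N by (intro mult_left_mono mult_right_mono) (auto simp: field_simps)
  finally show ?case by (simp add: ennreal_leI mult.assoc mult.left_commute)
qed

lemma prob_num_left:
  assumes "1 \<le> n"
  shows "measure shuffle_space {\<omega>\<in>space shuffle_space. num_left n \<omega> t > 1} \<le> real n * (1 - 1 / real n) ^ t"
proof -
  have "emeasure shuffle_space {\<omega>\<in>space shuffle_space. num_left n \<omega> t > 1}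
    \<le> (\<integral>\<^sup>+\<omega>. ennreal (real (num_left n \<omega> t) - 1) \<partial>shuffle_space)"
  proof -
    let ?A = "{\<omega>\<in>space shuffle_space. num_left n \<omega> t > 1}"
    have "emeasure shuffle_space ?A = (\<integral>\<^sup>+\<omega>. indicator ?A \<omega> \<partial>shuffle_space)"
      by (rule nn_integral_indicator[symmetric]) measurable
    also have "\<dots> \<le> (\<integral>\<^sup>+\<omega>. ennreal (real (num_left n \<omega> t) - 1) \<partial>shuffle_space)"
    proof (rule nn_integral_mono)
      fix \<omega> :: "nat \<Rightarrow> nat \<Rightarrow> nat list"
      show "indicator ?A \<omega> \<le> ennreal (real (num_left n \<omega> t) - 1)"
        using ennreal_leI[of 1 "real (num_left n \<omega> t) - 1"] by (auto simp: indicator_def)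
    qed
    finally show ?thesis .
  qed
  also have "\<dots> \<le> ennreal ((1 - 1 / real n) ^ t * (real n - 1))"
    by (rule nn_integral_num_left) (use assms in auto)
  also have "\<dots> \<le> ennreal (real n * (1 - 1 / real n) ^ t)"
    using assms by (intro ennreal_leI) (simp add: algebra_simps)
  finally show ?thesis
    using assms by (subst (asm) shuffle.emeasure_eq_measure) (auto simp: ennreal_le_iff)
qed

text \<open>Each factor measure lives on all lists and is merely concentrated on permutations, so
  pathwise statements about blocks hold only almost surely.\<close>

lemma AE_blocks_permutation:
  "AE \<omega> in shuffle_space. \<forall>t k. \<omega> t k \<in> permutations_of_set {1..k}"
proof -
  have "AE \<omega> in shuffle_space. \<omega> t k \<in> permutations_of_set {1..k}" for t k
  proof -
    let ?p = "\<lambda>k::nat. measure_pmf (pmf_of_set (permutations_of_set {1..k}))"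
    have "AE \<tau> in ?p k. \<tau> \<in> permutations_of_set {1..k}"
      by (simp add: AE_measure_pmf_iff)
    then have "AE s in perm_family. s k \<in> permutations_of_set {1..k}"
      unfolding perm_family_def
      by (intro AE_PiM_component) (auto intro: prob_space_measure_pmf)
    then show ?thesis
      unfolding shuffle_space_eq
      by (intro AE_PiM_component[where P = "\<lambda>s. s k \<in> permutations_of_set {1..k}"])
         (auto intro: prob_space_perm_family)
  qed
  then show ?thesis by (simp add: AE_all_countable)
qed

lemma AE_num_left_pos:
  assumes "n \<ge> 1"
  shows "AE \<omega> in shuffle_space. \<forall>t. num_left n \<omega> t \<ge> 1"
  using AE_blocks_permutation
proof eventually_elim
  case (elim \<omega>)
  show ?case
  proof
    fix t
    show "num_left n \<omega> t \<ge> 1"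
    proof (induction t)
      case (Suc t)
      have "\<omega> t (num_left n \<omega> t) \<in> permutations_of_set {1..num_left n \<omega> t}" using elim by blast
      from card_blocks_permutation[OF this] successions_less[OF Suc this] show ?case by simp
    qed (use assms in simp)
  qed
qed

lemma AE_terminates:
  assumes "n \<ge> 1"
  shows "AE \<omega> in shuffle_space. \<exists>t. num_left n \<omega> t = 1"
proof -
  let ?A = "{\<omega>\<in>space shuffle_space. \<forall>t. num_left n \<omega> t > 1}"
  have "measure shuffle_space ?A \<le> real n * (1 - 1 / real n) ^ t" for t
    by (rule order_trans[OF _ prob_num_left[OF assms]]) (intro shuffle.finite_measure_mono; auto)
  moreover have "(\<lambda>t. real n * (1 - 1 / real n) ^ t) \<longlonglongrightarrow> real n * 0"
    using assms by (intro tendsto_mult tendsto_const LIMSEQ_power_zero) (auto simp: field_simps)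
  ultimately have "measure shuffle_space ?A \<le> real n * 0"
    by (intro LIMSEQ_le_const) auto
  then have "measure shuffle_space ?A = 0" by (simp add: measure_le_0_iff)
  then have "AE \<omega> in shuffle_space. \<not> (\<forall>t. num_left n \<omega> t > 1)"
    by (subst (asm) shuffle.prob_eq_0) auto
  then show ?thesis
    using AE_num_left_pos[OF assms] by eventually_elim (metis le_neq_implies_less)
qed

lemma num_perms_gt: "t < num_perms n \<omega> \<Longrightarrow> num_left n \<omega> t \<noteq> 1"
  unfolding num_perms_def by (rule not_less_Least)

text \<open>The tail decays like \<open>(1 - 1 / n) ^ t\<close>, and the base
  \<open>1 + 1 / n\<close> still beats it: the product of the two is
  \<open>1 - 1 / n\<^sup>2 < 1\<close>. One exponential moment dominates all powers at once.\<close>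

lemma integrable_exp_num_perms:
  assumes "n \<ge> 1"
  shows "integrable shuffle_space (\<lambda>\<omega>. (1 + 1 / real n) ^ num_perms n \<omega>)"
proof -
  define c where "c = 1 + 1 / real n"
  define q where "q = 1 - 1 / real n"
  have c: "c > 1" and q: "0 \<le> q"
    using assms by (auto simp: c_def q_def field_simps)
  have "(1 + x) * (1 - x) = 1 - x ^ 2" for x :: real by (simp add: algebra_simps power2_eq_square)
  from this[of "1 / real n"] have "c * q = 1 - (1 / real n) ^ 2" by (simp only: c_def q_def)
  moreover have "(1 / real n) ^ 2 > 0" using assms by simp
  ultimately have "c * q < 1" by linarith
  moreover have "0 \<le> c * q" using c q by simp
  ultimately have cq: "0 \<le> c * q" "c * q < 1" by auto
  have gt: "emeasure shuffle_space {\<omega>\<in>space shuffle_space. t < num_perms n \<omega>} \<le> ennreal (real n * q ^ t)" for t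
  proof -
    have "emeasure shuffle_space {\<omega>\<in>space shuffle_space. t < num_perms n \<omega>}
       \<le> emeasure shuffle_space {\<omega>\<in>space shuffle_space. num_left n \<omega> t > 1}"
    proof (rule emeasure_mono_AE)
      show "AE \<omega> in shuffle_space. \<omega> \<in> {\<omega>\<in>space shuffle_space. t < num_perms n \<omega>} \<longrightarrow>
          \<omega> \<in> {\<omega>\<in>space shuffle_space. num_left n \<omega> t > 1}"
        using AE_num_left_pos[OF assms]
      proof eventually_elim
        case (elim \<omega>)
        have "1 < num_left n \<omega> t" if "t < num_perms n \<omega>"
          using elim[rule_format, of t] num_perms_gt[OF that] by linarith
        then show ?case by blast
      qed
    qed measurable
    also have "\<dots> \<le> ennreal (real n * q ^ t)"
      using prob_num_left[OF assms, of t] by (simp add: shuffle.emeasure_eq_measure ennreal_leI q_def)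
    finally show ?thesis .
  qed
  \<comment> \<open>Layer-cake form of \<open>c ^ k\<close>: it turns the expectation into a series
    over tail probabilities.\<close>
  have pow: "ennreal (c ^ k) = 1 + (\<Sum>t. ennreal ((c - 1) * c ^ t) * indicator {..<k} t)" for k
  proof -
    have "(\<Sum>t. ennreal ((c - 1) * c ^ t) * indicator {..<k} t) = (\<Sum>t<k. ennreal ((c - 1) * c ^ t))"
      by (subst suminf_finite[of "{..<k}"]) auto
    also have "\<dots> = ennreal ((c - 1) * (\<Sum>t<k. c ^ t))"
      using c by (subst sum_ennreal) (auto simp: sum_distrib_left)
    also have "(c - 1) * (\<Sum>t<k. c ^ t) = c ^ k - 1"
      by (simp add: power_diff_1_eq)
    finally show ?thesis
      using c by (simp flip: ennreal_1 ennreal_plus)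
  qed
  have "(\<integral>\<^sup>+\<omega>. ennreal (c ^ num_perms n \<omega>) \<partial>shuffle_space) =
     1 + (\<Sum>t. (\<integral>\<^sup>+\<omega>. ennreal ((c - 1) * c ^ t) * indicator {..<num_perms n \<omega>} t \<partial>shuffle_space))"
    unfolding pow
    by (subst nn_integral_add) (auto simp: nn_integral_suminf shuffle.emeasure_space_1 indicator_def)
  also have "\<dots> \<le> 1 + (\<Sum>t. ennreal ((c - 1) * n * (c * q) ^ t))"
  proof (intro add_left_mono suminf_le allI)
    fix t
    have "(\<integral>\<^sup>+\<omega>. ennreal ((c - 1) * c ^ t) * indicator {..<num_perms n \<omega>} t \<partial>shuffle_space)
       = ennreal ((c - 1) * c ^ t) * (\<integral>\<^sup>+\<omega>. indicator {\<omega>\<in>space shuffle_space. t < num_perms n \<omega>} \<omega> \<partial>shuffle_space)"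
      by (subst nn_integral_cmult[symmetric]) (auto intro!: nn_integral_cong simp: indicator_def)
    also have "\<dots> = ennreal ((c - 1) * c ^ t) * emeasure shuffle_space {\<omega>\<in>space shuffle_space. t < num_perms n \<omega>}"
      by (subst nn_integral_indicator) auto
    also have "\<dots> \<le> ennreal ((c - 1) * c ^ t) * ennreal (real n * q ^ t)"
      by (intro mult_left_mono gt) auto
    also have "\<dots> = ennreal ((c - 1) * n * (c * q) ^ t)"
      using c q by (subst ennreal_mult[symmetric]) (auto simp: power_mult_distrib mult_ac)
    finally show "(\<integral>\<^sup>+\<omega>. ennreal ((c - 1) * c ^ t) * indicator {..<num_perms n \<omega>} t \<partial>shuffle_space)
       \<le> ennreal ((c - 1) * n * (c * q) ^ t)" .
  qed auto
  also have "(\<Sum>t. ennreal ((c - 1) * n * (c * q) ^ t)) = ennreal (\<Sum>t. (c - 1) * n * (c * q) ^ t)"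
    using c cq by (intro suminf_ennreal2 summable_mult summable_geometric) auto
  also have "1 + \<dots> < \<infinity>" by simp
  finally show ?thesis
    unfolding c_def[symmetric]
    by (intro integrableI_nonneg) (use c in auto)
qed

lemma integrable_num_perms_power:
  assumes "n \<ge> 1"
  shows "integrable shuffle_space (\<lambda>\<omega>. (real (num_perms n \<omega>) - a) ^ m)"
proof -
  define c where "c = 1 + 1 / real n"
  have c: "c > 1" using assms by (simp add: c_def)
  have "(\<lambda>k. (real k - a) ^ m / c ^ k) \<longlonglongrightarrow> 0"
    using c by real_asymp
  then have "Bseq (\<lambda>k. (real k - a) ^ m / c ^ k)"
    by (intro convergent_imp_Bseq convergentI)
  then obtain K where K: "\<And>k. \<bar>(real k - a) ^ m / c ^ k\<bar> \<le> K"
    unfolding Bseq_def by auto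
  show ?thesis
  proof (rule Bochner_Integration.integrable_bound)
    show "integrable shuffle_space (\<lambda>\<omega>. K * c ^ num_perms n \<omega>)"
      unfolding c_def by (intro integrable_mult_right integrable_exp_num_perms assms)
    have "\<bar>(real k - a) ^ m\<bar> \<le> \<bar>K * c ^ k\<bar>" for k
      using K[of k] c order_trans[OF _ abs_ge_self[of "K * c ^ k"], of "\<bar>(real k - a) ^ m\<bar>"]
      by (simp add: field_simps)
    then show "AE \<omega> in shuffle_space. norm ((real (num_perms n \<omega>) - a) ^ m) \<le> norm (K * c ^ num_perms n \<omega>)"
      by simp
  qed measurable
qed

text \<open>For \<open>n \<noteq> 1\<close> the process has not ended at time 0, so the minimum can
  be shifted by one. Termination is assumed because \<open>LEAST\<close> carries no information
  otherwise.\<close>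

lemma num_perms_case_nat:
  assumes "n \<noteq> 1" "\<exists>t. num_left n (case_nat s \<omega>) t = 1"
  shows "num_perms n (case_nat s \<omega>) = Suc (num_perms (card (blocks (s n))) \<omega>)"
proof -
  from assms(2) obtain t where "num_left n (case_nat s \<omega>) t = 1" by blast
  then have "num_perms n (case_nat s \<omega>) = Suc (LEAST t. num_left n (case_nat s \<omega>) (Suc t) = 1)"
    unfolding num_perms_def using assms(1) by (intro Least_Suc) auto
  then show ?thesis unfolding num_left_case_nat num_perms_def .
qed

text \<open>Termination, known for the composed sequence, is pulled back to the product of the first
  slice and the rest, where the first permutation contributes the summand 1. The free shift
  \<open>a\<close> serves the mean and the central moments alike.\<close>

lemma integral_num_perms_step:
  assumes "n \<ge> 2"
  shows "(\<integral>\<omega>. (real (num_perms n \<omega>) - a) ^ m \<partial>shuffle_space) =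
    Ed n (\<lambda>d. \<integral>\<omega>. (real (num_perms (n - d) \<omega>) + 1 - a) ^ m \<partial>shuffle_space)"
proof -
  define h where "h k = (\<integral>\<omega>. (real (num_perms k \<omega>) + 1 - a) ^ m \<partial>shuffle_space)" for k
  have n: "n \<ge> 1" "n \<noteq> 1" using assms by auto
  have "AE \<omega> in distr (perm_family \<Otimes>\<^sub>M shuffle_space) shuffle_space (\<lambda>(s, \<omega>). case_nat s \<omega>).
      \<exists>t. num_left n \<omega> t = 1"
    unfolding distr_case_nat_shuffle by (rule AE_terminates[OF n(1)])
  then have "AE x in perm_family \<Otimes>\<^sub>M shuffle_space. \<exists>t. num_left n (case x of (s, \<omega>) \<Rightarrow> case_nat s \<omega>) t = 1"
    by (subst (asm) AE_distr_iff) auto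
  then have "AE s in perm_family. AE \<omega> in shuffle_space. \<exists>t. num_left n (case_nat s \<omega>) t = 1"
    by (auto dest: pair.AE_pair)
  then have eq: "AE s in perm_family.
     (\<integral>\<omega>. (real (num_perms n (case_nat s \<omega>)) - a) ^ m \<partial>shuffle_space) = h (card (blocks (s n)))"
  proof eventually_elim
    case (elim s)
    have [measurable]: "case_nat s \<in> shuffle_space \<rightarrow>\<^sub>M shuffle_space"
    proof -
      have "(\<lambda>\<omega>. (s, \<omega>)) \<in> shuffle_space \<rightarrow>\<^sub>M perm_family \<Otimes>\<^sub>M shuffle_space"
        by (rule measurable_Pair1') (simp add: perm_family_def space_PiM)
      from measurable_compose[OF this measurable_case_nat_shuffle] show ?thesis by simp
    qed
    show ?case
      unfolding h_def
    proof (rule integral_cong_AE)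
      show "AE \<omega> in shuffle_space. (real (num_perms n (case_nat s \<omega>)) - a) ^ m =
          (real (num_perms (card (blocks (s n))) \<omega>) + 1 - a) ^ m"
        using elim by eventually_elim (simp add: num_perms_case_nat[OF n(2)] add_ac)
    qed measurable
  qed
  have "(\<integral>\<omega>. (real (num_perms n \<omega>) - a) ^ m \<partial>shuffle_space) =
    (\<integral>s. (\<integral>\<omega>. (real (num_perms n (case_nat s \<omega>)) - a) ^ m \<partial>shuffle_space) \<partial>perm_family)"
    by (rule integral_shuffle_step) (rule integrable_num_perms_power[OF n(1)])
  also have "\<dots> = (\<integral>s. h (card (blocks (s n))) \<partial>perm_family)"
    by (rule integral_cong_AE) (use eq in measurable)
  also have "\<dots> = Ed n (\<lambda>d. h (n - d))" by (rule integral_perm_family_blocks)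
  finally show ?thesis unfolding h_def .
qed

lemma integrable_num_perms:
  "n \<ge> 1 \<Longrightarrow> integrable shuffle_space (\<lambda>\<omega>. real (num_perms n \<omega>))"
  using integrable_num_perms_power[of n 0 1] by simp

lemma mean_num_perms_step:
  assumes "n \<ge> 2"
  shows "mean_num_perms n = 1 + Ed n (\<lambda>d. mean_num_perms (n - d))"
proof -
  have "mean_num_perms n = Ed n (\<lambda>d. \<integral>\<omega>. real (num_perms (n - d) \<omega>) + 1 \<partial>shuffle_space)"
    using integral_num_perms_step[OF assms, of 0 1] by (simp add: mean_num_perms_def)
  also have "\<dots> = Ed n (\<lambda>d. mean_num_perms (n - d) + 1)"
    using assms by (intro Ed_cong)
      (auto simp: mean_num_perms_def integrable_num_perms shuffle.prob_space)
  finally show ?thesis unfolding Ed_add by simp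
qed

lemma central_moment_step:
  assumes "n \<ge> 2"
  shows "central_moment m n = Ed n (\<lambda>d. \<Sum>j\<le>m. real (m choose j) * central_moment j (n - d) *
     (1 + mean_num_perms (n - d) - mean_num_perms n) ^ (m - j))"
proof -
  have "central_moment m n =
      Ed n (\<lambda>d. \<integral>\<omega>. (real (num_perms (n - d) \<omega>) + 1 - mean_num_perms n) ^ m \<partial>shuffle_space)"
    unfolding central_moment_def by (rule integral_num_perms_step[OF assms])
  also have "\<dots> = Ed n (\<lambda>d. \<Sum>j\<le>m. real (m choose j) * central_moment j (n - d) *
     (1 + mean_num_perms (n - d) - mean_num_perms n) ^ (m - j))"
  proof (rule Ed_cong)
    fix d assume d: "d < n"
    let ?\<mu> = "mean_num_perms (n - d)" and ?e = "1 + mean_num_perms (n - d) - mean_num_perms n"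
    \<comment> \<open>Recentre at the mean belonging to the new state \<open>n - d\<close>; the
      discrepancy of the two centres is the deterministic \<open>?e\<close>.\<close>
    have "(\<integral>\<omega>. (real (num_perms (n - d) \<omega>) + 1 - mean_num_perms n) ^ m \<partial>shuffle_space) =
        (\<integral>\<omega>. ((real (num_perms (n - d) \<omega>) - ?\<mu>) + ?e) ^ m \<partial>shuffle_space)"
      by (simp add: algebra_simps)
    also have "\<dots> = (\<integral>\<omega>. (\<Sum>j\<le>m. real (m choose j) * (real (num_perms (n - d) \<omega>) - ?\<mu>) ^ j * ?e ^ (m - j)) \<partial>shuffle_space)"
      by (simp only: binomial_ring)
    also have "\<dots> = (\<Sum>j\<le>m. real (m choose j) * central_moment j (n - d) * ?e ^ (m - j))"
      unfolding central_moment_def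
      using d by (subst Bochner_Integration.integral_sum)
        (auto intro!: integrable_mult_left integrable_mult_right integrable_num_perms_power)
    finally show "(\<integral>\<omega>. (real (num_perms (n - d) \<omega>) + 1 - mean_num_perms n) ^ m \<partial>shuffle_space) =
       (\<Sum>j\<le>m. real (m choose j) * central_moment j (n - d) * ?e ^ (m - j))" .
  qed (use assms in simp)
  finally show ?thesis .
qed

lemma central_moment_0 [simp]: "central_moment 0 n = 1"
  by (simp add: central_moment_def shuffle.prob_space)

lemma central_moment_1:
  "n \<ge> 1 \<Longrightarrow> central_moment (Suc 0) n = 0"
  by (simp add: central_moment_def integrable_num_perms shuffle.prob_space flip: mean_num_perms_def)

section \<open>Recurrences along the process\<close>

text \<open>A big-O bound by \<open>r n\<close>, uniform in the loss \<open>d\<close> up to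
  polynomial growth. This growth is harmless because all polynomial moments of the loss are bounded
  in \<open>n\<close>. Functions of \<open>n\<close> alone enter as constant in
  \<open>d\<close>.\<close>

definition poly_dom :: "(nat \<Rightarrow> real) \<Rightarrow> (nat \<Rightarrow> nat \<Rightarrow> real) \<Rightarrow> bool" where
  "poly_dom r F \<longleftrightarrow> (\<exists>C p. \<forall>n\<ge>1. \<forall>d<n. \<bar>F n d\<bar> \<le> C * (1 + real d) ^ p * \<bar>r n\<bar>)"

lemma poly_domD:
  assumes "poly_dom r F"
  shows "\<exists>C\<ge>0. \<exists>p. \<forall>n\<ge>1. \<forall>d<n. \<bar>F n d\<bar> \<le> C * (1 + real d) ^ p * \<bar>r n\<bar>"
proof -
  from assms obtain C p where C: "\<And>n d. n \<ge> 1 \<Longrightarrow> d < n \<Longrightarrow> \<bar>F n d\<bar> \<le> C * (1 + real d) ^ p * \<bar>r n\<bar>"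
    unfolding poly_dom_def by blast
  have "\<bar>F n d\<bar> \<le> \<bar>C\<bar> * (1 + real d) ^ p * \<bar>r n\<bar>" if "n \<ge> 1" "d < n" for n d
    by (rule order_trans[OF C[OF that]]) (intro mult_right_mono, auto)
  then show ?thesis by (intro exI[of _ "\<bar>C\<bar>"]) auto
qed

lemma poly_domI:
  "(\<And>n d. n \<ge> 1 \<Longrightarrow> d < n \<Longrightarrow> \<bar>F n d\<bar> \<le> C * (1 + real d) ^ p * \<bar>r n\<bar>) \<Longrightarrow> poly_dom r F"
  unfolding poly_dom_def by blast

lemma poly_dom_fst_iff:
  "poly_dom r (\<lambda>n d. f n) \<longleftrightarrow> (\<exists>C. \<forall>n\<ge>1. \<bar>f n\<bar> \<le> C * \<bar>r n\<bar>)"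
proof
  assume "poly_dom r (\<lambda>n d. f n)"
  then obtain C p where "\<And>n d. n \<ge> 1 \<Longrightarrow> d < n \<Longrightarrow> \<bar>f n\<bar> \<le> C * (1 + real d) ^ p * \<bar>r n\<bar>"
    unfolding poly_dom_def by blast
  from this[of _ 0] show "\<exists>C. \<forall>n\<ge>1. \<bar>f n\<bar> \<le> C * \<bar>r n\<bar>" by (intro exI[of _ C]) auto
next
  assume "\<exists>C. \<forall>n\<ge>1. \<bar>f n\<bar> \<le> C * \<bar>r n\<bar>"
  then obtain C where "\<And>n. n \<ge> 1 \<Longrightarrow> \<bar>f n\<bar> \<le> C * \<bar>r n\<bar>" by blast
  then show "poly_dom r (\<lambda>n d. f n)" by (intro poly_domI[of _ C 0]) auto
qed

text \<open>The finitely many exceptional \<open>n\<close> are absorbed into the constant, which is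
  possible because \<open>r\<close> does not vanish there.\<close>

lemma poly_dom_fst_eventuallyI:
  assumes "\<And>n. n \<ge> N \<Longrightarrow> n \<ge> 1 \<Longrightarrow> \<bar>f n\<bar> \<le> C * \<bar>r n\<bar>" "\<And>n. n \<ge> 1 \<Longrightarrow> r n \<noteq> 0"
  shows "poly_dom r (\<lambda>n d. f n)"
proof -
  define B where "B = (\<Sum>k\<in>{1..N}. \<bar>f k\<bar> / \<bar>r k\<bar>)"
  have B: "B \<ge> 0" unfolding B_def by (intro sum_nonneg) auto
  have "\<bar>f n\<bar> \<le> (\<bar>C\<bar> + B) * \<bar>r n\<bar>" if n: "n \<ge> 1" for n
  proof (cases "n \<ge> N")
    case True
    have "C * \<bar>r n\<bar> \<le> (\<bar>C\<bar> + B) * \<bar>r n\<bar>" using B by (intro mult_right_mono) auto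
    then show ?thesis using assms(1)[OF True n] by linarith
  next
    case False
    have "\<bar>f n\<bar> / \<bar>r n\<bar> \<le> B"
      unfolding B_def by (rule member_le_sum) (use False n in auto)
    then have "\<bar>f n\<bar> \<le> B * \<bar>r n\<bar>" using assms(2)[OF n] by (simp add: field_simps)
    also have "\<dots> \<le> (\<bar>C\<bar> + B) * \<bar>r n\<bar>" by (intro mult_right_mono) auto
    finally show ?thesis .
  qed
  then show ?thesis unfolding poly_dom_fst_iff by blast
qed

lemma poly_dom_cong:
  assumes "poly_dom r F" "\<And>n d. n \<ge> 1 \<Longrightarrow> d < n \<Longrightarrow> G n d = F n d"
  shows "poly_dom r G"
  using assms unfolding poly_dom_def by simp

lemma poly_dom_fst_cong:
  assumes "poly_dom r (\<lambda>n d. f n)" "\<And>n. n \<ge> N \<Longrightarrow> n \<ge> 1 \<Longrightarrow> g n = f n" "\<And>n. n \<ge> 1 \<Longrightarrow> r n \<noteq> 0"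
  shows "poly_dom r (\<lambda>n d. g n)"
proof -
  from assms(1) obtain C where "\<And>n. n \<ge> 1 \<Longrightarrow> \<bar>f n\<bar> \<le> C * \<bar>r n\<bar>"
    unfolding poly_dom_fst_iff by blast
  then show ?thesis
    using assms(2,3) by (intro poly_dom_fst_eventuallyI[of N g C]) auto
qed

lemma poly_dom_mono:
  assumes "poly_dom r F" "\<And>n. n \<ge> 1 \<Longrightarrow> \<bar>r n\<bar> \<le> K * \<bar>r' n\<bar>"
  shows "poly_dom r' F"
proof -
  obtain C p where C: "C \<ge> 0"
    "\<And>n d. n \<ge> 1 \<Longrightarrow> d < n \<Longrightarrow> \<bar>F n d\<bar> \<le> C * (1 + real d) ^ p * \<bar>r n\<bar>"
    using poly_domD[OF assms(1)] by blast
  show ?thesis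
  proof (rule poly_domI[of _ "C * K" p])
    fix n d :: nat assume n: "n \<ge> 1" "d < n"
    have "C * (1 + real d) ^ p * \<bar>r n\<bar> \<le> C * (1 + real d) ^ p * (K * \<bar>r' n\<bar>)"
      using C(1) assms(2)[OF n(1)] by (intro mult_left_mono) auto
    then show "\<bar>F n d\<bar> \<le> C * K * (1 + real d) ^ p * \<bar>r' n\<bar>"
      using C(2)[OF n] by (simp add: mult_ac)
  qed
qed

lemma poly_dom_mult:
  assumes "poly_dom r F" "poly_dom s G"
  shows "poly_dom (\<lambda>n. r n * s n) (\<lambda>n d. F n d * G n d)"
proof -
  obtain C p where C: "C \<ge> 0"
    "\<And>n d. n \<ge> 1 \<Longrightarrow> d < n \<Longrightarrow> \<bar>F n d\<bar> \<le> C * (1 + real d) ^ p * \<bar>r n\<bar>"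
    using poly_domD[OF assms(1)] by blast
  obtain D q where D: "D \<ge> 0"
    "\<And>n d. n \<ge> 1 \<Longrightarrow> d < n \<Longrightarrow> \<bar>G n d\<bar> \<le> D * (1 + real d) ^ q * \<bar>s n\<bar>"
    using poly_domD[OF assms(2)] by blast
  show ?thesis
  proof (rule poly_domI[of _ "C * D" "p + q"])
    fix n d :: nat assume n: "n \<ge> 1" "d < n"
    have "\<bar>F n d * G n d\<bar> \<le> (C * (1 + real d) ^ p * \<bar>r n\<bar>) * (D * (1 + real d) ^ q * \<bar>s n\<bar>)"
      unfolding abs_mult using C(1) by (intro mult_mono C(2) D(2) n) auto
    then show "\<bar>F n d * G n d\<bar> \<le> C * D * (1 + real d) ^ (p + q) * \<bar>r n * s n\<bar>"
      by (simp add: power_add abs_mult mult_ac)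
  qed
qed

lemma poly_dom_add:
  assumes "poly_dom r F" "poly_dom r G"
  shows "poly_dom r (\<lambda>n d. F n d + G n d)"
proof -
  obtain C p where C: "C \<ge> 0"
    "\<And>n d. n \<ge> 1 \<Longrightarrow> d < n \<Longrightarrow> \<bar>F n d\<bar> \<le> C * (1 + real d) ^ p * \<bar>r n\<bar>"
    using poly_domD[OF assms(1)] by blast
  obtain D q where D: "D \<ge> 0"
    "\<And>n d. n \<ge> 1 \<Longrightarrow> d < n \<Longrightarrow> \<bar>G n d\<bar> \<le> D * (1 + real d) ^ q * \<bar>r n\<bar>"
    using poly_domD[OF assms(2)] by blast
  show ?thesis
  proof (rule poly_domI[of _ "C + D" "p + q"])
    fix n d :: nat assume n: "n \<ge> 1" "d < n"
    have "C * (1 + real d) ^ p * \<bar>r n\<bar> \<le> C * (1 + real d) ^ (p + q) * \<bar>r n\<bar>"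
      "D * (1 + real d) ^ q * \<bar>r n\<bar> \<le> D * (1 + real d) ^ (p + q) * \<bar>r n\<bar>"
      using C(1) D(1) by (auto intro!: mult_right_mono mult_left_mono power_increasing)
    then show "\<bar>F n d + G n d\<bar> \<le> (C + D) * (1 + real d) ^ (p + q) * \<bar>r n\<bar>"
      using C(2)[OF n] D(2)[OF n] abs_triangle_ineq[of "F n d" "G n d"] by (simp add: ring_distribs)
  qed
qed

lemma poly_dom_zero [simp]: "poly_dom r (\<lambda>n d. 0)"
  by (rule poly_domI[of _ 0 0]) auto

lemma poly_dom_cmult:
  assumes "poly_dom r F"
  shows "poly_dom r (\<lambda>n d. c * F n d)"
proof -
  have "poly_dom (\<lambda>_. 1) (\<lambda>n d. c)" by (rule poly_domI[of _ "\<bar>c\<bar>" 0]) auto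
  from poly_dom_mult[OF this assms] show ?thesis by simp
qed

lemma poly_dom_diff:
  assumes "poly_dom r F" "poly_dom r G"
  shows "poly_dom r (\<lambda>n d. F n d - G n d)"
  using poly_dom_add[OF assms(1) poly_dom_cmult[OF assms(2), of "-1"]] by simp

lemma poly_dom_sum:
  assumes "\<And>i. i \<in> I \<Longrightarrow> poly_dom r (F i)"
  shows "poly_dom r (\<lambda>n d. \<Sum>i\<in>I. F i n d)"
  using assms by (induction I rule: infinite_finite_induct) (auto intro: poly_dom_add)

lemma poly_dom_const: "poly_dom (\<lambda>_. 1) (\<lambda>n d. c)"
  by (rule poly_domI[of _ "\<bar>c\<bar>" 0]) auto

lemma poly_dom_snd: "poly_dom (\<lambda>_. 1) (\<lambda>n d. real d)"
  by (rule poly_domI[of _ 1 1]) auto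

lemma poly_dom_power:
  assumes "poly_dom (\<lambda>_. 1) F"
  shows "poly_dom (\<lambda>_. 1) (\<lambda>n d. F n d ^ k)"
proof (induction k)
  case 0
  then show ?case using poly_dom_const[of 1] by simp
next
  case (Suc k)
  then show ?case using poly_dom_mult[OF assms Suc] by simp
qed

lemma poly_dom_self: "poly_dom r (\<lambda>n d. r n)"
  by (rule poly_domI[of _ 1 0]) auto

section \<open>Moments of the loss, bounded uniformly in the state\<close>

lemma Ed_two_power:
  assumes "n \<ge> 1"
  shows "Ed n (\<lambda>d. 2 ^ d) \<le> exp 1"
proof -
  have "Ed n (\<lambda>d. 2 ^ d) = Ed n (\<lambda>d. \<Sum>r\<le>n. real (d choose r))"
  proof (rule Ed_cong[OF assms])
    fix d assume "d < n"
    have "(2::real) ^ d = (\<Sum>r\<le>d. real (d choose r))"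
      using choose_row_sum[of d] by (metis of_nat_sum of_nat_power of_nat_numeral)
    also have "\<dots> = (\<Sum>r\<le>n. real (d choose r))"
      by (rule sum.mono_neutral_left) (use \<open>d < n\<close> in auto)
    finally show "(2::real) ^ d = (\<Sum>r\<le>n. real (d choose r))" .
  qed
  \<comment> \<open>Every factorial moment stays below its Poisson value \<open>1 / fact r\<close>,
    so the sum stays below \<open>exp 1\<close>, the mean of \<open>2 ^ D\<close> for a Poisson
    variable of mean 1.\<close>
  also have "\<dots> = (\<Sum>r\<le>n. (1 - real r / real n) / fact r)"
    unfolding Ed_sum by (rule sum.cong) (use Ed_binomial assms in auto)
  also have "\<dots> \<le> (\<Sum>r\<le>n. 1 / fact r)"
    by (intro sum_mono divide_right_mono) auto
  also have "\<dots> \<le> (\<Sum>r. 1 / fact r)"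
    using summable_exp[of "1::real"] by (intro sum_le_suminf) (auto simp: field_simps)
  also have "\<dots> = exp 1" by (simp add: exp_def field_simps)
  finally show ?thesis .
qed

lemma Ed_power_bounded: "\<exists>K. \<forall>n\<ge>1. Ed n (\<lambda>d. (1 + real d) ^ p) \<le> K"
proof -
  have "(\<lambda>d. (1 + real d) ^ p / 2 ^ d) \<longlonglongrightarrow> 0" by real_asymp
  then have "Bseq (\<lambda>d. (1 + real d) ^ p / 2 ^ d)"
    by (intro convergent_imp_Bseq convergentI)
  then obtain K where K: "K > 0" "\<And>d. (1 + real d) ^ p / 2 ^ d \<le> K"
    unfolding Bseq_def by (auto dest: abs_le_D1)
  have "Ed n (\<lambda>d. (1 + real d) ^ p) \<le> K * exp 1" if n: "n \<ge> 1" for n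
  proof -
    have "Ed n (\<lambda>d. (1 + real d) ^ p) \<le> Ed n (\<lambda>d. K * 2 ^ d)"
      by (rule Ed_mono[OF n]) (use K(2) in \<open>simp add: field_simps\<close>)
    also have "\<dots> \<le> K * exp 1"
      unfolding Ed_cmult using Ed_two_power[OF n] K(1) by (intro mult_left_mono) auto
    finally show ?thesis .
  qed
  then show ?thesis by blast
qed

lemma poly_dom_Ed:
  assumes "poly_dom r F"
  shows "poly_dom r (\<lambda>n d. Ed n (F n))"
proof -
  obtain C p where C: "C \<ge> 0"
    "\<And>n d. n \<ge> 1 \<Longrightarrow> d < n \<Longrightarrow> \<bar>F n d\<bar> \<le> C * (1 + real d) ^ p * \<bar>r n\<bar>"
    using poly_domD[OF assms] by blast
  obtain K where K: "\<And>n. n \<ge> 1 \<Longrightarrow> Ed n (\<lambda>d. (1 + real d) ^ p) \<le> K"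
    using Ed_power_bounded by blast
  have "\<bar>Ed n (F n)\<bar> \<le> C * K * \<bar>r n\<bar>" if n: "n \<ge> 1" for n
  proof -
    have "\<bar>Ed n (F n)\<bar> \<le> Ed n (\<lambda>d. \<bar>F n d\<bar>)" by (rule Ed_abs)
    also have "\<dots> \<le> Ed n (\<lambda>d. C * (1 + real d) ^ p * \<bar>r n\<bar>)"
      by (rule Ed_mono[OF n]) (rule C(2)[OF n])
    also have "\<dots> = C * Ed n (\<lambda>d. (1 + real d) ^ p) * \<bar>r n\<bar>"
      by (simp only: Ed_multc Ed_cmult)
    also have "\<dots> \<le> C * K * \<bar>r n\<bar>"
      using C(1) K[OF n] by (intro mult_right_mono mult_left_mono) auto
    finally show ?thesis .
  qed
  then show ?thesis unfolding poly_dom_fst_iff by blast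
qed

text \<open>Admits nondecreasing functions as well as \<open>1 / n\<close>, for which the correction
  factor is attained at \<open>i = n - 1\<close>. For fixed \<open>i\<close> the factor tends to 1;
  losing a fixed factor could use up the margin of the contraction argument.\<close>

definition rate :: "(nat \<Rightarrow> real) \<Rightarrow> bool" where
  "rate r \<longleftrightarrow> (\<forall>n\<ge>1. 0 \<le> r n) \<and>
     (\<forall>n i. i < n \<longrightarrow> r (n - i) \<le> r n * (1 + real i * (1 + real i) / real n))"

lemma rateD:
  assumes "rate r"
  shows "n \<ge> 1 \<Longrightarrow> 0 \<le> r n" "i < n \<Longrightarrow> r (n - i) \<le> r n * (1 + real i * (1 + real i) / real n)"
  using assms unfolding rate_def by auto

lemma rate_shift:
  assumes "rate r" "i < n"
  shows "r (n - i) \<le> r n * (1 + real i) ^ 2"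
proof -
  have "real i * (1 + real i) / real n \<le> real i * (1 + real i)"
    using assms(2) mult_left_mono[of 1 "real n" "real i * (1 + real i)"] by (simp add: divide_le_eq)
  also have "\<dots> \<le> (1 + real i) ^ 2 - 1" by (simp add: power2_eq_square algebra_simps)
  finally have "r n * (1 + real i * (1 + real i) / real n) \<le> r n * (1 + real i) ^ 2"
    using rateD(1)[OF assms(1), of n] assms(2) by (intro mult_left_mono) auto
  then show ?thesis using rateD(2)[OF assms] by linarith
qed

lemma rate_mono:
  assumes "\<And>n. n \<ge> 1 \<Longrightarrow> 0 \<le> r n" "\<And>k n. 1 \<le> k \<Longrightarrow> k \<le> n \<Longrightarrow> r k \<le> r n"
  shows "rate r"
  unfolding rate_def
proof (intro conjI allI impI)
  fix n i :: nat assume i: "i < n"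
  have "r (n - i) \<le> r n * 1" using assms(2)[of "n - i" n] i by simp
  also have "\<dots> \<le> r n * (1 + real i * (1 + real i) / real n)"
    using assms(1)[of n] i by (intro mult_left_mono) auto
  finally show "r (n - i) \<le> r n * (1 + real i * (1 + real i) / real n)" .
qed (use assms(1) in auto)

lemma rate_inverse: "rate (\<lambda>n. 1 / real n)"
  unfolding rate_def
proof (intro conjI allI impI)
  fix n i :: nat assume i: "i < n"
  have "real n * real n \<le> real n * real n + real i * (real i * (real n - 1 - real i))"
    using i by auto
  also have "\<dots> = (real n - real i) * (real n + real i * (1 + real i))"
    by (simp add: algebra_simps)
  finally have "real n * real n \<le> \<dots>" .
  then show "1 / real (n - i) \<le> 1 / real n * (1 + real i * (1 + real i) / real n)"
    using i by (simp add: of_nat_diff divide_simps) (simp add: algebra_simps)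
qed auto

lemma poly_dom_shift:
  assumes "rate r" "poly_dom r (\<lambda>n d. f n)"
  shows "poly_dom r (\<lambda>n d. f (n - d))"
proof -
  from assms(2) obtain C where C: "\<And>n. n \<ge> 1 \<Longrightarrow> \<bar>f n\<bar> \<le> C * \<bar>r n\<bar>"
    unfolding poly_dom_fst_iff by blast
  show ?thesis
  proof (rule poly_domI[of _ "\<bar>C\<bar>" 2])
    fix n d :: nat assume n: "n \<ge> 1" "d < n"
    have "\<bar>f (n - d)\<bar> \<le> C * \<bar>r (n - d)\<bar>" using C n by simp
    also have "\<dots> \<le> \<bar>C\<bar> * (r n * (1 + real d) ^ 2)"
      using rate_shift[OF assms(1) n(2)] rateD(1)[OF assms(1), of "n - d"] n
      by (intro mult_mono) auto
    finally show "\<bar>f (n - d)\<bar> \<le> \<bar>C\<bar> * (1 + real d) ^ 2 * \<bar>r n\<bar>"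
      using rateD(1)[OF assms(1) n(1)] by (simp add: mult_ac)
  qed
qed

definition lip :: "(nat \<Rightarrow> real) \<Rightarrow> (nat \<Rightarrow> real) \<Rightarrow> bool" where
  "lip r g \<longleftrightarrow> (\<exists>C. \<forall>n\<ge>2. \<bar>g n - g (n - 1)\<bar> \<le> C * r n)"

lemma diff_le_of_increments:
  fixes g :: "nat \<Rightarrow> real"
  assumes "\<And>i. i < e \<Longrightarrow> \<bar>g (n - i) - g (n - Suc i)\<bar> \<le> B"
  shows "\<bar>g n - g (n - e)\<bar> \<le> real e * B"
  using assms
proof (induction e)
  case (Suc e)
  have "\<bar>g n - g (n - e)\<bar> \<le> real e * B" "\<bar>g (n - e) - g (n - Suc e)\<bar> \<le> B"
    using Suc by auto
  then show ?case by (simp add: algebra_simps)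
qed simp

lemma poly_dom_increment:
  assumes "rate r" "lip r g"
  shows "poly_dom r (\<lambda>n d. g (n - d) - g n)"
proof -
  from assms(2) obtain C0 where C0: "\<And>n. n \<ge> 2 \<Longrightarrow> \<bar>g n - g (n - 1)\<bar> \<le> C0 * r n"
    unfolding lip_def by blast
  define C where "C = \<bar>C0\<bar>"
  show ?thesis
  proof (rule poly_domI[of _ C 3])
    fix n d :: nat assume n: "n \<ge> 1" "d < n"
    have r: "r n \<ge> 0" using rateD(1)[OF assms(1) n(1)] .
    have "\<bar>g n - g (n - d)\<bar> \<le> real d * (C * (r n * (1 + real d) ^ 2))"
    proof (rule diff_le_of_increments)
      fix i assume i: "i < d"
      have "\<bar>g (n - i) - g (n - Suc i)\<bar> \<le> C0 * r (n - i)"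
        using C0[of "n - i"] n i by simp
      also have "\<dots> \<le> C * r (n - i)"
        unfolding C_def using rateD(1)[OF assms(1), of "n - i"] i n by (intro mult_right_mono) auto
      also have "\<dots> \<le> C * (r n * (1 + real i) ^ 2)"
        unfolding C_def using rate_shift[OF assms(1), of i n] i n by (intro mult_left_mono) auto
      also have "\<dots> \<le> C * (r n * (1 + real d) ^ 2)"
        unfolding C_def using r i by (intro mult_left_mono power_mono) auto
      finally show "\<bar>g (n - i) - g (n - Suc i)\<bar> \<le> C * (r n * (1 + real d) ^ 2)" .
    qed
    also have "\<dots> \<le> (1 + real d) * (C * (r n * (1 + real d) ^ 2))"
      using r by (intro mult_right_mono mult_nonneg_nonneg) (auto simp: C_def)
    finally show "\<bar>g (n - d) - g n\<bar> \<le> C * (1 + real d) ^ 3 * \<bar>r n\<bar>"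
      using r by (simp add: abs_minus_commute power3_eq_cube power2_eq_square mult_ac)
  qed
qed

text \<open>Summation of increments: if \<open>r\<close> is below the increments of
  \<open>s\<close>, the sum telescopes to \<open>s\<close>, and positivity of \<open>s 1\<close>
  absorbs the initial value of \<open>g\<close>.\<close>

lemma poly_dom_of_lip:
  assumes "lip r g" "\<And>n. n \<ge> 2 \<Longrightarrow> 0 \<le> r n" "\<And>n. n \<ge> 2 \<Longrightarrow> r n \<le> s n - s (n - 1)" "s 1 > 0"
  shows "poly_dom s (\<lambda>n d. g n)"
proof -
  from assms(1) obtain C0 where C0: "\<And>n. n \<ge> 2 \<Longrightarrow> \<bar>g n - g (n - 1)\<bar> \<le> C0 * r n"
    unfolding lip_def by blast
  define C where "C = \<bar>C0\<bar>"
  have *: "s 1 \<le> s n \<and> \<bar>g n\<bar> \<le> \<bar>g 1\<bar> + C * (s n - s 1)" if "n \<ge> 1" for n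
    using that
  proof (induction n rule: dec_induct)
    case (step n)
    have n: "Suc n \<ge> 2" using step by simp
    have "\<bar>g (Suc n) - g n\<bar> \<le> C0 * r (Suc n)" using C0[OF n] by simp
    also have "\<dots> \<le> C * r (Suc n)" unfolding C_def using assms(2)[OF n] by (intro mult_right_mono) auto
    also have "\<dots> \<le> C * (s (Suc n) - s n)"
      unfolding C_def using assms(3)[OF n] by (intro mult_left_mono) auto
    finally have "\<bar>g (Suc n) - g n\<bar> \<le> C * (s (Suc n) - s n)" .
    moreover have "s n \<le> s (Suc n)" using assms(2,3)[OF n] by simp
    moreover have "\<bar>g (Suc n)\<bar> \<le> \<bar>g n\<bar> + \<bar>g (Suc n) - g n\<bar>" by linarith
    ultimately show ?case using step.IH by (simp add: algebra_simps)
  qed simp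
  have "\<bar>g n\<bar> \<le> (\<bar>g 1\<bar> / s 1 + C) * \<bar>s n\<bar>" if "n \<ge> 1" for n
  proof -
    have s: "s 1 \<le> s n" using *[OF that] by simp
    have "\<bar>g 1\<bar> = \<bar>g 1\<bar> / s 1 * s 1" using assms(4) by simp
    also have "\<dots> \<le> \<bar>g 1\<bar> / s 1 * s n" using assms(4) s by (intro mult_left_mono) auto
    finally have "\<bar>g 1\<bar> \<le> \<bar>g 1\<bar> / s 1 * s n" .
    moreover have "C * (s n - s 1) \<le> C * s n" using assms(4) by (intro mult_left_mono) (auto simp: C_def)
    ultimately show ?thesis using *[OF that] s assms(4) by (simp add: ring_distribs)
  qed
  then show ?thesis unfolding poly_dom_fst_iff by blast
qed

section \<open>Contraction for increments\<close>

lemma Ed_id: "n \<ge> 1 \<Longrightarrow> Ed n real = 1 - 1 / real n"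
  using Ed_binomial[of 1 n] by simp

text \<open>Bonferroni bound of order 4, with limit \<open>1 - 1 + 1/2 - 1/6 + 1/24 = 3/8\<close>.
  Order 2 would give only 1/2 in the limit, whereas the contraction needs a value strictly below
  1/2.\<close>

lemma Ed_no_succession_le:
  assumes "n \<ge> 4"
  shows "Ed n (\<lambda>d. of_bool (d = 0)) \<le> 3 / 8 + 1 / (3 * real n)"
proof -
  \<comment> \<open>For \<open>d = e + 1\<close> the alternating sum collapses by Pascal's rule to
    \<open>e choose 4\<close>, which is nonnegative.\<close>
  have pt: "of_bool (d = 0) \<le> (1 - real (d choose 1) + real (d choose 2))
     - real (d choose 3) + real (d choose 4)" for d
  proof (cases d)
    case (Suc e)
    have "(1 - real (d choose 1) + real (d choose 2))
     - real (d choose 3) + real (d choose 4) = real (e choose 4)"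
      unfolding Suc by (simp add: numeral_eq_Suc)
    then show ?thesis using Suc by simp
  qed (simp add: numeral_eq_Suc)
  have "Ed n (\<lambda>d. of_bool (d = 0)) \<le> Ed n (\<lambda>d. (1 - real (d choose 1) + real (d choose 2))
     - real (d choose 3) + real (d choose 4))"
    by (rule Ed_mono) (use assms pt in auto)
  also have "\<dots> = 3 / 8 + 1 / (3 * real n)"
  proof -
    have b: "Ed n (\<lambda>d. real (d choose r)) = (1 - real r / real n) / fact r" if "r \<le> 4" for r
      using assms that by (intro Ed_binomial) auto
    have "Ed n (\<lambda>d. (1 - real (d choose 1) + real (d choose 2))
        - real (d choose 3) + real (d choose 4)) =
      1 - (1 - real 1 / real n) / fact 1 + (1 - real 2 / real n) / fact 2
        - (1 - real 3 / real n) / fact 3 + (1 - real 4 / real n) / fact 4"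
      unfolding Ed_add Ed_diff Ed_const by (subst (1 2 3 4) b) simp_all
    also have "\<dots> = 3 / 8 + 1 / (3 * real n)"
      by (simp add: fact_numeral field_simps)
    finally show ?thesis .
  qed
  finally show ?thesis .
qed

text \<open>The equation determines \<open>g n - g (n - 1)\<close> up to the increments further down: those enter
  with total weight \<open>E (D - 1)\<^sup>+ \<le> 3/8\<close>, while \<open>g n - g (n - 1)\<close> has weight \<open>P (D \<ge> 1) \<ge> 1/2\<close>.\<close>

lemma lip_of_recurrence:
  assumes "rate r" and pos: "\<And>n. n \<ge> 1 \<Longrightarrow> 0 < r n"
    and h: "poly_dom r (\<lambda>n d. g n - Ed n (\<lambda>d. g (n - d)))"
  shows "lip r g"
proof -
  from h obtain A0 where A0: "\<And>n. n \<ge> 1 \<Longrightarrow> \<bar>g n - Ed n (\<lambda>d. g (n - d))\<bar> \<le> A0 * \<bar>r n\<bar>"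
    unfolding poly_dom_fst_iff by blast
  define A where "A = \<bar>A0\<bar>"
  have A: "\<bar>g n - Ed n (\<lambda>d. g (n - d))\<bar> \<le> A * r n" if "n \<ge> 1" for n
  proof -
    have "A0 * \<bar>r n\<bar> \<le> A * r n" unfolding A_def using pos[OF that] by (intro mult_mono) auto
    then show ?thesis using A0[OF that] by linarith
  qed
  obtain K where K: "\<And>n. n \<ge> 1 \<Longrightarrow> Ed n (\<lambda>d. (1 + real d) ^ 3) \<le> K"
    using Ed_power_bounded by blast
  \<comment> \<open>Beyond \<open>16 * K\<close> the correction terms of \<open>rate\<close> cost at
    most 1/16, which raises the weight 3/8 to 7/16, still below 1/2. The summand 4 makes the
    Bonferroni bound applicable.\<close>
  define N where "N = nat \<lceil>16 * K\<rceil> + 4"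
  have N: "16 * K \<le> real n" if "n \<ge> N" for n
    using that real_nat_ceiling_ge[of "16 * K"] unfolding N_def by linarith
  \<comment> \<open>The sum covers \<open>n \<le> N\<close> directly. With
    \<open>C \<ge> 16 * A\<close> the forcing takes at most \<open>C / 16\<close>, and
    \<open>1/16 + 7/16 = 1/2\<close> closes the induction.\<close>
  define C where "C = 16 * A + (\<Sum>k\<in>{1..N}. \<bar>g k - g (k - 1)\<bar> / r k)"
  have sum0: "(\<Sum>k\<in>{1..N}. \<bar>g k - g (k - 1)\<bar> / r k) \<ge> 0"
    using pos by (intro sum_nonneg divide_nonneg_pos) auto
  have C: "C \<ge> 16 * A" "C \<ge> 0" using sum0 by (auto simp: C_def A_def)
  have "\<bar>g n - g (n - 1)\<bar> \<le> C * r n" if "n \<ge> 2" for n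
    using that
  proof (induction n rule: less_induct)
    case (less n)
    have n1: "n \<ge> 1" using less.prems by simp
    have r0: "r n > 0" using pos[OF n1] .
    show ?case
    proof (cases "n \<le> N")
      case True
      have "\<bar>g n - g (n - 1)\<bar> / r n \<le> (\<Sum>k\<in>{1..N}. \<bar>g k - g (k - 1)\<bar> / r k)"
        using True less.prems pos by (intro member_le_sum) (auto intro!: divide_nonneg_pos)
      also have "\<dots> \<le> C" by (simp add: C_def A_def)
      finally show ?thesis using r0 by (simp add: field_simps)
    next
      case False
      then have nN: "n \<ge> 4" "16 * K \<le> real n" using N[of n] by (auto simp: N_def)
      define q where "q = Ed n (\<lambda>d. of_bool (d = 0))"
      \<comment> \<open>For \<open>d \<ge> 1\<close> the second argument is \<open>n - d\<close>;
        for \<open>d = 0\<close> truncated subtraction gives \<open>R 0 = 0\<close>, as needed when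
        nothing is lost.\<close>
      define R where "R d = g (n - 1) - g (n - 1 - (d - 1))" for d
      have q: "q \<le> 3 / 8 + 1 / (3 * real n)" unfolding q_def by (rule Ed_no_succession_le[OF nN(1)])
      also have "1 / (3 * real n) \<le> 1 / 12" using nN(1) by (simp add: field_simps)
      finally have q': "1 - q \<ge> 1 / 2" by simp
      have "g n - Ed n (\<lambda>d. g (n - d)) = Ed n (\<lambda>d. g n - g (n - d))"
        by (simp only: Ed_diff Ed_const)
      also have "\<dots> = Ed n (\<lambda>d. (1 - of_bool (d = 0)) * (g n - g (n - 1)) + R d)"
        by (rule Ed_cong[OF n1]) (auto simp: R_def)
      also have "\<dots> = (1 - q) * (g n - g (n - 1)) + Ed n R"
        unfolding Ed_add Ed_multc Ed_diff Ed_const q_def ..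
      finally have eq: "(1 - q) * (g n - g (n - 1)) = (g n - Ed n (\<lambda>d. g (n - d))) - Ed n R"
        by simp
      have Rd: "\<bar>R d\<bar> \<le> C * r n * ((real d - 1 + of_bool (d = 0)) + (1 + real d) ^ 3 * (1 / real n))"
        if d: "d < n" for d
      proof -
        let ?e = "d - 1"
        have "\<bar>R d\<bar> \<le> real ?e * (C * (r n * (1 + real d * (1 + real d) / real n)))"
          unfolding R_def
        proof (rule diff_le_of_increments)
          fix i assume i: "i < d - 1"
          have "\<bar>g (n - 1 - i) - g (n - 1 - Suc i)\<bar> \<le> C * r (n - Suc i)"
            using less.IH[of "n - Suc i"] i d by simp
          also have "\<dots> \<le> C * (r n * (1 + real (Suc i) * (1 + real (Suc i)) / real n))"
            using rateD(2)[OF assms(1), of "Suc i" n] i d C(2) by (intro mult_left_mono) auto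
          also have "\<dots> \<le> C * (r n * (1 + real d * (1 + real d) / real n))"
            using i d C(2) r0 by (intro mult_left_mono add_left_mono divide_right_mono mult_mono) auto
          finally show "\<bar>g (n - 1 - i) - g (n - 1 - Suc i)\<bar>
            \<le> C * (r n * (1 + real d * (1 + real d) / real n))" .
        qed
        also have "\<dots> = C * r n * (real ?e + real ?e * real d * (1 + real d) * (1 / real n))"
          by (simp add: ring_distribs mult_ac add_divide_distrib)
        also have "\<dots> \<le> C * r n * (real ?e + (1 + real d) * (1 + real d) * (1 + real d) * (1 / real n))"
          using C(2) r0 by (intro mult_left_mono add_left_mono mult_right_mono mult_mono) auto
        \<comment> \<open>The truncated \<open>d - 1\<close> is made linear at the price of the
          indicator of \<open>d = 0\<close>; its mean is then \<open>q - 1 / n\<close>, so the bound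
          on \<open>q\<close> controls both sides of the contraction.\<close>
        also have "real ?e = real d - 1 + of_bool (d = 0)" by (cases d) auto
        finally show ?thesis by (simp add: power3_eq_cube mult_ac)
      qed
      have "\<bar>Ed n R\<bar> \<le> Ed n (\<lambda>d. \<bar>R d\<bar>)" by (rule Ed_abs)
      also have "\<dots> \<le> Ed n (\<lambda>d. C * r n * ((real d - 1 + of_bool (d = 0)) + (1 + real d) ^ 3 * (1 / real n)))"
        by (rule Ed_mono[OF n1]) (rule Rd)
      also have "\<dots> = C * r n * (1 - 1 / real n - 1 + q + Ed n (\<lambda>d. (1 + real d) ^ 3) * (1 / real n))"
        unfolding Ed_cmult Ed_add Ed_diff Ed_multc Ed_const Ed_id[OF n1] q_def ..
      also have "\<dots> \<le> C * r n * (7 / 16)"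
      proof (intro mult_left_mono)
        have "Ed n (\<lambda>d. (1 + real d) ^ 3) * (1 / real n) \<le> K * (1 / real n)"
          using K[OF n1] by (intro mult_right_mono) auto
        also have "\<dots> \<le> 1 / 16" using nN by (simp add: field_simps)
        finally have "Ed n (\<lambda>d. (1 + real d) ^ 3) * (1 / real n) \<le> 1 / 16" .
        moreover have "1 / (3 * real n) \<le> 1 / real n" using nN(1) by (simp add: field_simps)
        ultimately show "1 - 1 / real n - 1 + q + Ed n (\<lambda>d. (1 + real d) ^ 3) * (1 / real n) \<le> 7 / 16"
          using q by linarith
      qed (use C r0 in auto)
      finally have ER: "\<bar>Ed n R\<bar> \<le> C * r n * (7 / 16)" .
      have "1 / 2 * \<bar>g n - g (n - 1)\<bar> \<le> (1 - q) * \<bar>g n - g (n - 1)\<bar>"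
        using q' by (intro mult_right_mono) auto
      also have "\<dots> = \<bar>(1 - q) * (g n - g (n - 1))\<bar>" using q' by (simp add: abs_mult)
      also have "\<dots> \<le> A * r n + C * r n * (7 / 16)" unfolding eq using A[OF n1] ER by linarith
      also have "A * r n \<le> C / 16 * r n" using C r0 by (intro mult_right_mono) auto
      finally show ?thesis by simp
    qed
  qed
  then show ?thesis unfolding lip_def by blast
qed

section \<open>Asymptotics of the central moments\<close>

definition eps :: "nat \<Rightarrow> nat \<Rightarrow> real" where
  "eps n d = 1 + mean_num_perms (n - d) - mean_num_perms n"

lemma lip_mean: "lip (\<lambda>n. 1 / real n) (\<lambda>n. mean_num_perms n - real n)"
proof (rule lip_of_recurrence[OF rate_inverse])
  show "poly_dom (\<lambda>n. 1 / real n)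
     (\<lambda>n d. (mean_num_perms n - real n) - Ed n (\<lambda>d. mean_num_perms (n - d) - real (n - d)))"
  proof (rule poly_dom_fst_cong[where N = 2, OF poly_dom_self])
    fix n :: nat assume n: "n \<ge> 2" "n \<ge> 1"
    have "Ed n (\<lambda>d. real (n - d)) = Ed n (\<lambda>d. real n - real d)"
      using n by (intro Ed_cong) auto
    then have "Ed n (\<lambda>d. real (n - d)) = real n - (1 - 1 / real n)"
      using Ed_id[OF n(2)] by (simp add: Ed_diff)
    then show "(mean_num_perms n - real n) - Ed n (\<lambda>d. mean_num_perms (n - d) - real (n - d)) = 1 / real n"
      using mean_num_perms_step[OF n(1)] by (simp add: Ed_diff)
  qed simp
qed simp

lemma eps_approx: "poly_dom (\<lambda>n. 1 / real n) (\<lambda>n d. eps n d - (1 - real d))"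
  by (rule poly_dom_cong[OF poly_dom_increment[OF rate_inverse lip_mean]]) (simp add: eps_def of_nat_diff)

lemma poly_dom_inverse_imp_1:
  assumes "poly_dom (\<lambda>n. 1 / real n) F"
  shows "poly_dom (\<lambda>_. 1) F"
  by (rule poly_dom_mono[OF assms, of 1]) simp

lemma poly_dom_eps: "poly_dom (\<lambda>_. 1) eps"
proof -
  have "poly_dom (\<lambda>_. 1) (\<lambda>n d. (eps n d - (1 - real d)) + (1 - real d))"
    by (intro poly_dom_add poly_dom_diff poly_dom_const poly_dom_snd poly_dom_inverse_imp_1 eps_approx)
  then show ?thesis by simp
qed

lemma Ed_eps: "n \<ge> 2 \<Longrightarrow> Ed n (eps n) = 0"
  using mean_num_perms_step[of n] by (simp add: eps_def[abs_def] Ed_add Ed_diff)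

lemma eps_power_approx: "poly_dom (\<lambda>n. 1 / real n) (\<lambda>n d. eps n d ^ k - (1 - real d) ^ k)"
proof (induction k)
  case (Suc k)
  have "poly_dom (\<lambda>n. 1 * (1 / real n)) (\<lambda>n d. eps n d * (eps n d ^ k - (1 - real d) ^ k))"
    by (intro poly_dom_mult poly_dom_eps Suc)
  moreover have "poly_dom (\<lambda>n. 1 / real n * 1) (\<lambda>n d. (eps n d - (1 - real d)) * (1 - real d) ^ k)"
    by (intro poly_dom_mult eps_approx poly_dom_power poly_dom_diff poly_dom_const poly_dom_snd)
  ultimately have "poly_dom (\<lambda>n. 1 / real n)
    (\<lambda>n d. eps n d * (eps n d ^ k - (1 - real d) ^ k) + (eps n d - (1 - real d)) * (1 - real d) ^ k)"
    by (intro poly_dom_add) simp_all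
  then show ?case by (simp add: algebra_simps)
qed simp

text \<open>Transfers a limit from the explicit \<open>H\<close> to \<open>G\<close>. The range
  \<open>n \<ge> 3\<close> is where factorial moments up to order 3 are available.\<close>

lemma Ed_approx:
  assumes "poly_dom (\<lambda>n. 1 / real n) (\<lambda>n d. G n d - H d)"
    "\<And>n. n \<ge> 3 \<Longrightarrow> \<bar>Ed n H - \<kappa>\<bar> \<le> C * (1 / real n)"
  shows "poly_dom (\<lambda>n. 1 / real n) (\<lambda>n d. Ed n (G n) - \<kappa>)"
proof -
  have "poly_dom (\<lambda>n. 1 / real n) (\<lambda>n d. Ed n H - \<kappa>)"
    by (rule poly_dom_fst_eventuallyI[of 3 _ C]) (use assms(2) in auto)
  from poly_dom_add[OF poly_dom_Ed[OF assms(1)] this] show ?thesis by (simp add: Ed_diff)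
qed

lemma real_choose_two: "real (n choose 2) = real n * (real n - 1) / 2"
  by (induction n) (auto simp: numeral_2_eq_2 field_simps)

lemma real_choose_three: "real (n choose 3) = real n * (real n - 1) * (real n - 2) / 6"
proof (induction n)
  case (Suc n)
  have "Suc n choose 3 = (n choose 2) + (n choose 3)" by (simp add: numeral_eq_Suc)
  then show ?case using Suc real_choose_two[of n] by (simp add: field_simps)
qed simp

text \<open>The mean is exactly 0 from \<open>n = 2\<close> on; the state 1 takes no step and is
  left to the constant.\<close>

lemma Ed_eps_1: "poly_dom (\<lambda>n. 1 / real n) (\<lambda>n d. Ed n (\<lambda>d. eps n d ^ 1) - 0)"
  by (rule poly_dom_fst_cong[where N = 2, OF poly_dom_zero]) (simp_all add: Ed_eps)

lemma Ed_eps_2: "poly_dom (\<lambda>n. 1 / real n) (\<lambda>n d. Ed n (\<lambda>d. eps n d ^ 2) - 1)"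
proof (rule Ed_approx[OF eps_power_approx])
  fix n :: nat assume n: "n \<ge> 3"
  \<comment> \<open>Rewriting in the binomial basis makes the exact factorial moments
    applicable.\<close>
  have pt: "(\<lambda>d. (1 - real d)\<^sup>2) = (\<lambda>d. 1 - real (d choose 1) + 2 * real (d choose 2))"
    by (rule ext) (simp add: real_choose_two power2_eq_square field_simps)
  have "Ed n (\<lambda>d. (1 - real d)\<^sup>2) = 1 - 1 / real n"
    unfolding pt Ed_add Ed_diff Ed_cmult Ed_const
    using n Ed_binomial[of 1 n] Ed_binomial[of 2 n] by (simp add: field_simps)
  then show "\<bar>Ed n (\<lambda>d. (1 - real d)\<^sup>2) - 1\<bar> \<le> 1 * (1 / real n)" by simp
qed

lemma Ed_eps_3: "poly_dom (\<lambda>n. 1 / real n) (\<lambda>n d. Ed n (\<lambda>d. eps n d ^ 3) - (- 1))"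
proof (rule Ed_approx[OF eps_power_approx])
  fix n :: nat assume n: "n \<ge> 3"
  have pt: "(\<lambda>d. (1 - real d) ^ 3) = (\<lambda>d. 1 - real (d choose 1) - 6 * real (d choose 3))"
    by (rule ext) (simp add: real_choose_three power3_eq_cube field_simps)
  have "Ed n (\<lambda>d. (1 - real d) ^ 3) = -1 + 4 / real n"
    unfolding pt Ed_add Ed_diff Ed_cmult Ed_const
    using n Ed_binomial[of 1 n] Ed_binomial[of 3 n] by (simp add: fact_numeral field_simps)
  then show "\<bar>Ed n (\<lambda>d. (1 - real d) ^ 3) - (- 1)\<bar> \<le> 4 * (1 / real n)" by simp
qed

text \<open>This limiting covariance of loss and deviation decides what a term linear in
  \<open>d\<close> contributes at odd orders.\<close>

lemma Ed_d_eps: "poly_dom (\<lambda>n. 1 / real n) (\<lambda>n d. Ed n (\<lambda>d. real d * eps n d) - (- 1))"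
proof (rule Ed_approx)
  have "poly_dom (\<lambda>n. 1 * (1 / real n)) (\<lambda>n d. real d * (eps n d - (1 - real d)))"
    by (intro poly_dom_mult poly_dom_snd eps_approx)
  then show "poly_dom (\<lambda>n. 1 / real n) (\<lambda>n d. real d * eps n d - real d * (1 - real d))"
    by (simp add: algebra_simps)
  fix n :: nat assume n: "n \<ge> 3"
  have "real d * (1 - real d) = (- 2) * real (d choose 2)" for d
    by (simp add: real_choose_two algebra_simps)
  then have "Ed n (\<lambda>d. real d * (1 - real d)) = -1 + 2 / real n"
    using n Ed_binomial[of 2 n] by (simp only: Ed_cmult) (simp add: field_simps)
  then show "\<bar>Ed n (\<lambda>d. real d * (1 - real d)) - (- 1)\<bar> \<le> 2 * (1 / real n)" by simp
qed

section \<open>Scales for errors and for their increments\<close>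

text \<open>\<open>err_rate M\<close> bounds the error terms of the central moments of orders \<open>2 * M\<close> and \<open>2 * M + 1\<close>,
  \<open>incr_rate M\<close> their increments. The increments need their own bound:
  \<open>\<epsilon>\<close> is centred, so at odd orders the error of the preceding order enters only through its
  increments, which are smaller by a factor \<open>n\<close>.\<close>

fun incr_rate :: "nat \<Rightarrow> nat \<Rightarrow> real" where
  "incr_rate 0 n = 0"
| "incr_rate (Suc 0) n = 1 / real n"
| "incr_rate (Suc (Suc M)) n = real n ^ M * (1 + ln (real n))"

fun err_rate :: "nat \<Rightarrow> nat \<Rightarrow> real" where
  "err_rate 0 n = 0"
| "err_rate (Suc M) n = real n ^ M * (1 + ln (real n))"

lemma rate_power_ln: "rate (\<lambda>n. real n ^ M * (1 + ln (real n)))"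
  by (rule rate_mono) (auto intro!: mult_mono power_mono mult_nonneg_nonneg simp: add_nonneg_nonneg)

lemma rate_zero: "rate (\<lambda>_. 0)"
  by (simp add: rate_def)

lemma rate_err_rate: "rate (err_rate M)"
proof (cases M)
  case 0
  have "err_rate 0 = (\<lambda>_. 0)" by (rule ext) simp
  then show ?thesis using 0 rate_zero by simp
qed (use rate_power_ln in \<open>simp flip: err_rate.simps\<close>)

lemma rate_incr_rate: "rate (incr_rate M)"
proof (cases "(M, 0::nat)" rule: incr_rate.cases)
  case (1 n)
  have "incr_rate 0 = (\<lambda>_. 0)" by (rule ext) simp
  then show ?thesis using 1 rate_zero by simp
qed (use rate_inverse rate_power_ln in \<open>simp_all flip: incr_rate.simps\<close>)

lemma incr_rate_pos: "M \<ge> 1 \<Longrightarrow> n \<ge> 1 \<Longrightarrow> incr_rate M n > 0"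
  by (cases "(M, n)" rule: incr_rate.cases) (auto intro!: mult_pos_pos simp: add_pos_nonneg)

text \<open>What is an error at one level is still admissible as forcing one level higher; this lets
  the induction close without loss.\<close>

lemma err_rate_le_incr_rate: "n \<ge> 1 \<Longrightarrow> \<bar>err_rate M n\<bar> \<le> 1 * \<bar>incr_rate (Suc M) n\<bar>"
  by (cases M) auto

lemma power_le_power_ln: "n \<ge> 1 \<Longrightarrow> k \<le> M \<Longrightarrow> \<bar>real n ^ k\<bar> \<le> 1 * \<bar>real n ^ M * (1 + ln (real n))\<bar>"
proof -
  assume n: "n \<ge> 1" "k \<le> M"
  have "real n ^ k * 1 \<le> real n ^ M * (1 + ln (real n))"
    using n by (intro mult_mono power_increasing) auto
  then show ?thesis by simp
qed

lemma power_div_le_incr_rate: "n \<ge> 1 \<Longrightarrow> \<bar>real n ^ M * (1 / real n)\<bar> \<le> 1 * \<bar>incr_rate (Suc M) n\<bar>"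
  using power_le_power_ln[of n "M - 1" "M - 1"] by (cases M) auto

lemma err_rate_le_power: "n \<ge> 1 \<Longrightarrow> \<bar>err_rate M n\<bar> \<le> 1 * \<bar>real n ^ M\<bar>"
proof (cases M)
  case (Suc K)
  assume n: "n \<ge> 1"
  have "real n ^ K * (1 + ln (real n)) \<le> real n ^ K * real n"
    using n ln_le_minus_one[of "real n"] by (intro mult_left_mono) auto
  then show ?thesis using Suc n by (simp add: abs_mult mult.commute)
qed simp

lemma power_le_incr_rate:
  "n \<ge> 1 \<Longrightarrow> k + 2 \<le> M \<Longrightarrow> \<bar>real n ^ k\<bar> \<le> 1 * \<bar>incr_rate M n\<bar>"
  using power_le_power_ln[of n k "M - 2"] by (cases "(M, n)" rule: incr_rate.cases) auto

section \<open>First- and second-order expansion of powers\<close>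

lemma power_diff_bound:
  fixes x y :: real
  assumes "0 \<le> y" "y \<le> x"
  shows "\<bar>(x - y) ^ Suc M - x ^ Suc M\<bar> \<le> real (Suc M) * y * x ^ M"
proof (induction M)
  case (Suc M)
  have "(x - y) ^ Suc (Suc M) - x ^ Suc (Suc M) = (x - y) * ((x - y) ^ Suc M - x ^ Suc M) - y * x ^ Suc M"
    by (simp add: algebra_simps)
  also have "\<bar>\<dots>\<bar> \<le> (x - y) * \<bar>(x - y) ^ Suc M - x ^ Suc M\<bar> + y * x ^ Suc M"
    using assms by (intro order_trans[OF abs_triangle_ineq4]) (auto simp: abs_mult)
  also have "\<dots> \<le> x * (real (Suc M) * y * x ^ M) + y * x ^ Suc M"
    using assms Suc by (intro add_right_mono mult_mono) auto
  finally show ?case by (simp add: algebra_simps)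
qed (use assms in simp)

text \<open>Taylor remainder after the linear term, which must stay explicit because it feeds the
  leading coefficients. The constant follows from
  \<open>(M + 2)\<^sup>2 + (M + 2) \<le> (M + 3)\<^sup>2\<close>.\<close>

lemma power_diff_bound2:
  fixes x y :: real
  assumes "0 \<le> y" "y \<le> x"
  shows "\<bar>(x - y) ^ Suc (Suc M) - x ^ Suc (Suc M) + real (Suc (Suc M)) * y * x ^ Suc M\<bar>
    \<le> (real (M + 2))\<^sup>2 * y\<^sup>2 * x ^ M"
proof (induction M)
  case 0
  have "(x - y) ^ Suc (Suc 0) - x ^ Suc (Suc 0) + real (Suc (Suc 0)) * y * x ^ Suc 0 = y\<^sup>2"
    by (simp add: power2_eq_square algebra_simps)
  then show ?case by simp
next
  case (Suc M)
  let ?D = "(x - y) ^ Suc (Suc M) - x ^ Suc (Suc M)"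
  have "(x - y) ^ Suc (Suc (Suc M)) - x ^ Suc (Suc (Suc M)) + real (Suc (Suc (Suc M))) * y * x ^ Suc (Suc M)
     = x * (?D + real (Suc (Suc M)) * y * x ^ Suc M) - y * ?D"
    by (simp add: algebra_simps)
  also have "\<bar>\<dots>\<bar> \<le> x * \<bar>?D + real (Suc (Suc M)) * y * x ^ Suc M\<bar> + y * \<bar>?D\<bar>"
    using assms by (intro order_trans[OF abs_triangle_ineq4]) (auto simp: abs_mult)
  also have "\<dots> \<le> x * ((real (M + 2))\<^sup>2 * y\<^sup>2 * x ^ M) + y * (real (Suc (Suc M)) * y * x ^ Suc M)"
    using assms Suc power_diff_bound[OF assms, of "Suc M"] by (intro add_mono mult_left_mono) auto
  also have "\<dots> = ((real (M + 2))\<^sup>2 + real (M + 2)) * (y\<^sup>2 * x ^ Suc M)"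
    by (simp add: power2_eq_square algebra_simps)
  also have "\<dots> \<le> (real (Suc M + 2))\<^sup>2 * (y\<^sup>2 * x ^ Suc M)"
    using assms by (intro mult_right_mono) (auto simp: power2_eq_square algebra_simps)
  finally show ?case by (simp add: mult_ac)
qed

lemma poly_dom_power_diff: "poly_dom (err_rate M) (\<lambda>n d. real (n - d) ^ M - real n ^ M)"
proof (cases M)
  case (Suc K)
  have "poly_dom (\<lambda>n. real n ^ K) (\<lambda>n d. real (n - d) ^ M - real n ^ M)"
  proof (rule poly_domI[of _ "real (Suc K)" 1])
    fix n d :: nat assume n: "n \<ge> 1" "d < n"
    have "\<bar>real (n - d) ^ M - real n ^ M\<bar> \<le> real (Suc K) * real d * real n ^ K"
      using power_diff_bound[of "real d" "real n" K] n Suc by (simp add: of_nat_diff)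
    also have "\<dots> \<le> real (Suc K) * (1 + real d) ^ 1 * \<bar>real n ^ K\<bar>"
      by (auto intro!: mult_right_mono mult_left_mono)
    finally show "\<bar>real (n - d) ^ M - real n ^ M\<bar> \<le> real (Suc K) * (1 + real d) ^ 1 * \<bar>real n ^ K\<bar>" .
  qed
  then show ?thesis
    by (rule poly_dom_mono[where K = 1]) (use Suc power_le_power_ln[of _ K K] in auto)
qed simp

lemma poly_dom_power_diff2:
  "poly_dom (incr_rate M) (\<lambda>n d. real (n - d) ^ M - real n ^ M + real M * real d * real n ^ (M - 1))"
proof (cases "(M, 0::nat)" rule: incr_rate.cases)
  case (2 n)
  have "poly_dom (incr_rate M) (\<lambda>n d. 0)" by simp
  then show ?thesis by (rule poly_dom_cong) (use 2 in \<open>auto simp: of_nat_diff\<close>)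
next
  case (3 K n)
  have "poly_dom (\<lambda>n. real n ^ K) (\<lambda>n d. real (n - d) ^ M - real n ^ M + real M * real d * real n ^ (M - 1))"
  proof (rule poly_domI[of _ "(real (K + 2))\<^sup>2" 2])
    fix n d :: nat assume n: "n \<ge> 1" "d < n"
    have "\<bar>real (n - d) ^ M - real n ^ M + real M * real d * real n ^ (M - 1)\<bar>
        \<le> (real (K + 2))\<^sup>2 * (real d)\<^sup>2 * real n ^ K"
      using power_diff_bound2[of "real d" "real n" K] n 3 by (simp add: of_nat_diff)
    also have "\<dots> \<le> (real (K + 2))\<^sup>2 * (1 + real d)\<^sup>2 * \<bar>real n ^ K\<bar>"
      by (auto intro!: mult_right_mono mult_left_mono power_mono)
    finally show "\<bar>real (n - d) ^ M - real n ^ M + real M * real d * real n ^ (M - 1)\<bar>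
      \<le> (real (K + 2))\<^sup>2 * (1 + real d)\<^sup>2 * \<bar>real n ^ K\<bar>" .
  qed
  then show ?thesis
    by (rule poly_dom_mono[where K = 1]) (use 3 power_le_power_ln[of _ K K] in auto)
qed simp

section \<open>Induction on the order of the moment\<close>

definition lead :: "nat \<Rightarrow> real" where
  "lead m = (if even m then real (double_fact (m - 1))
     else 2 / 3 * real (m div 2) * real (double_fact m))"

definition resid :: "nat \<Rightarrow> nat \<Rightarrow> real" where
  "resid m n = central_moment m n - lead m * real n ^ (m div 2)"

definition controlled :: "nat \<Rightarrow> bool" where
  "controlled m \<longleftrightarrow> lip (incr_rate (m div 2)) (resid m) \<and> poly_dom (err_rate (m div 2)) (\<lambda>n d. resid m n)"

lemma controlled_approx1:
  assumes "controlled m"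
  shows "poly_dom (err_rate (m div 2))
    (\<lambda>n d. central_moment m (n - d) - lead m * real n ^ (m div 2))"
proof -
  have "poly_dom (err_rate (m div 2))
    (\<lambda>n d. lead m * (real (n - d) ^ (m div 2) - real n ^ (m div 2)) + resid m (n - d))"
    using assms unfolding controlled_def
    by (intro poly_dom_add poly_dom_cmult poly_dom_power_diff poly_dom_shift rate_err_rate) auto
  then show ?thesis by (simp add: resid_def algebra_simps)
qed

lemma controlled_approx0:
  assumes "controlled m"
  shows "poly_dom (\<lambda>n. real n ^ (m div 2)) (\<lambda>n d. central_moment m (n - d))"
proof -
  have "poly_dom (\<lambda>n. real n ^ (m div 2)) (\<lambda>n d. (central_moment m (n - d) - lead m * real n ^ (m div 2))
     + lead m * real n ^ (m div 2))"
    by (intro poly_dom_add poly_dom_cmult poly_dom_self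
        poly_dom_mono[OF controlled_approx1[OF assms] err_rate_le_power])
  then show ?thesis by simp
qed

text \<open>Expands about \<open>central_moment m n\<close> itself and not about its leading term:
  the former is known less precisely than the change, but it drops out once multiplied by a centred
  quantity.\<close>

lemma controlled_approx2:
  assumes "controlled m"
  shows "poly_dom (incr_rate (m div 2)) (\<lambda>n d. central_moment m (n - d) - central_moment m n
     + lead m * (real (m div 2) * real d * real n ^ (m div 2 - 1)))"
proof -
  have "poly_dom (incr_rate (m div 2))
    (\<lambda>n d. lead m * (real (n - d) ^ (m div 2) - real n ^ (m div 2) + real (m div 2) * real d * real n ^ (m div 2 - 1))
       + (resid m (n - d) - resid m n))"
    using assms unfolding controlled_def
    by (intro poly_dom_add poly_dom_cmult poly_dom_power_diff2 poly_dom_increment rate_incr_rate) auto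
  then show ?thesis by (simp add: resid_def algebra_simps)
qed

text \<open>Two replacements, the moment by its leading term and the mean of the power of
  \<open>eps\<close> by its limit, each cost no more than the increment scale of the next
  level.\<close>

lemma term_approx:
  assumes "controlled m" "poly_dom (\<lambda>n. 1 / real n) (\<lambda>n d. Ed n (\<lambda>d. eps n d ^ k) - \<kappa>)"
  shows "poly_dom (incr_rate (Suc (m div 2)))
    (\<lambda>n d. Ed n (\<lambda>d. central_moment m (n - d) * eps n d ^ k) - lead m * \<kappa> * real n ^ (m div 2))"
proof -
  let ?J = "m div 2"
  have "poly_dom (\<lambda>n. err_rate ?J n * 1)
     (\<lambda>n d. (central_moment m (n - d) - lead m * real n ^ ?J) * eps n d ^ k)"
    by (intro poly_dom_mult poly_dom_power poly_dom_eps controlled_approx1 assms(1))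
  then have "poly_dom (err_rate ?J)
     (\<lambda>n d. Ed n (\<lambda>d. (central_moment m (n - d) - lead m * real n ^ ?J) * eps n d ^ k))"
    by (intro poly_dom_Ed) simp
  from poly_dom_mono[OF this err_rate_le_incr_rate]
  have 1: "poly_dom (incr_rate (Suc ?J))
     (\<lambda>n d. Ed n (\<lambda>d. (central_moment m (n - d) - lead m * real n ^ ?J) * eps n d ^ k))" .
  have "poly_dom (\<lambda>n. real n ^ ?J * (1 / real n)) (\<lambda>n d. real n ^ ?J * (Ed n (\<lambda>d. eps n d ^ k) - \<kappa>))"
    by (intro poly_dom_mult poly_dom_self assms(2))
  from poly_dom_mono[OF this power_div_le_incr_rate]
  have 2: "poly_dom (incr_rate (Suc ?J)) (\<lambda>n d. real n ^ ?J * (Ed n (\<lambda>d. eps n d ^ k) - \<kappa>))" .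
  show ?thesis
  proof (rule poly_dom_cong[OF poly_dom_add[OF 1 poly_dom_cmult[OF 2, of "lead m"]]])
    fix n d :: nat
    have "Ed n (\<lambda>d. (central_moment m (n - d) - lead m * real n ^ ?J) * eps n d ^ k)
      = Ed n (\<lambda>d. central_moment m (n - d) * eps n d ^ k) - lead m * real n ^ ?J * Ed n (\<lambda>d. eps n d ^ k)"
      by (simp only: left_diff_distrib Ed_diff Ed_cmult)
    then show "Ed n (\<lambda>d. central_moment m (n - d) * eps n d ^ k) - lead m * \<kappa> * real n ^ ?J =
      Ed n (\<lambda>d. (central_moment m (n - d) - lead m * real n ^ ?J) * eps n d ^ k) +
      lead m * (real n ^ ?J * (Ed n (\<lambda>d. eps n d ^ k) - \<kappa>))"
      by (simp add: algebra_simps)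
  qed
qed

text \<open>Two levels down, the crude size of the moment already lies within the permitted
  error.\<close>

lemma term_small:
  assumes "controlled m" "m div 2 + 2 \<le> M"
  shows "poly_dom (incr_rate M) (\<lambda>n d. Ed n (\<lambda>d. central_moment m (n - d) * eps n d ^ k))"
proof -
  have "poly_dom (\<lambda>n. real n ^ (m div 2) * 1) (\<lambda>n d. central_moment m (n - d) * eps n d ^ k)"
    by (intro poly_dom_mult poly_dom_power poly_dom_eps controlled_approx0 assms(1))
  then have "poly_dom (\<lambda>n. real n ^ (m div 2)) (\<lambda>n d. Ed n (\<lambda>d. central_moment m (n - d) * eps n d ^ k))"
    by (intro poly_dom_Ed) simp
  then show ?thesis by (rule poly_dom_mono) (rule power_le_incr_rate[OF _ assms(2)])
qed

text \<open>Here the moment is on the same level as the permitted error, so its own error would be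
  too large. As \<open>eps\<close> has mean 0, the value at \<open>n\<close> cancels; the linear
  drift against \<open>eps\<close> has covariance near -1, which turns the negative slope into a
  positive main term.\<close>

lemma term_linear:
  assumes "controlled m" "m div 2 = Suc K"
  shows "poly_dom (incr_rate (Suc K))
    (\<lambda>n d. Ed n (\<lambda>d. central_moment m (n - d) * eps n d ^ 1) - lead m * real (Suc K) * real n ^ K)"
proof -
  let ?R = "\<lambda>n d. central_moment m (n - d) - central_moment m n + lead m * (real (Suc K) * real d * real n ^ K)"
  have "poly_dom (\<lambda>n. incr_rate (Suc K) n * 1) (\<lambda>n d. ?R n d * eps n d)"
    using controlled_approx2[OF assms(1)] unfolding assms(2)
    by (intro poly_dom_mult poly_dom_eps) simp
  then have 1: "poly_dom (incr_rate (Suc K)) (\<lambda>n d. Ed n (\<lambda>d. ?R n d * eps n d))"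
    by (intro poly_dom_Ed) simp
  have "poly_dom (\<lambda>n. real n ^ K * (1 / real n)) (\<lambda>n d. real n ^ K * (Ed n (\<lambda>d. real d * eps n d) - (- 1)))"
    by (intro poly_dom_mult poly_dom_self Ed_d_eps)
  from poly_dom_mono[OF this power_div_le_incr_rate]
  have 2: "poly_dom (incr_rate (Suc K)) (\<lambda>n d. real n ^ K * (Ed n (\<lambda>d. real d * eps n d) - (- 1)))" .
  show ?thesis
  proof (rule poly_dom_fst_cong[where N = 2, OF poly_dom_diff[OF 1 poly_dom_cmult[OF 2, of "lead m * real (Suc K)"]]])
    fix n :: nat assume n: "n \<ge> 2"
    have "Ed n (\<lambda>d. ?R n d * eps n d) = Ed n (\<lambda>d. central_moment m (n - d) * eps n d)
       - central_moment m n * Ed n (eps n) + lead m * real (Suc K) * real n ^ K * Ed n (\<lambda>d. real d * eps n d)"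
      unfolding Ed_cmult[symmetric] Ed_diff[symmetric] Ed_add[symmetric] by (simp add: algebra_simps)
    then show "Ed n (\<lambda>d. central_moment m (n - d) * eps n d ^ 1) - lead m * real (Suc K) * real n ^ K =
      Ed n (\<lambda>d. ?R n d * eps n d)
        - lead m * real (Suc K) * (real n ^ K * (Ed n (\<lambda>d. real d * eps n d) - (- 1)))"
      using Ed_eps[OF n] by (simp add: algebra_simps)
  qed (use incr_rate_pos[of "Suc K"] in \<open>simp add: less_imp_neq[THEN not_sym]\<close>)
qed

text \<open>At \<open>K = 0\<close> truncated subtraction yields \<open>double_fact 0 = 1\<close>,
  the usual convention for the double factorial of -1; it also makes
  \<open>lead 0 = 1\<close>.\<close>

lemma double_fact_odd: "double_fact (2 * Suc K - 1) = (2 * K + 1) * double_fact (2 * K - 1)"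
  by (cases K) (auto simp: numeral_eq_Suc)

text \<open>Coefficient matching at order \<open>2 * K + 2\<close>: the drift of the leading power
  on the left, the variance term, with limit 1, on the right.\<close>

lemma lead_even:
  "real (Suc K) * lead (Suc (Suc (2 * K))) = real (Suc (Suc (2 * K)) choose 2) * lead (2 * K)"
  using double_fact_odd[of K] by (simp add: lead_def real_choose_two algebra_simps)

text \<open>Coefficient matching at order \<open>2 * K + 3\<close>, with three sources: the slope of
  the preceding moment, the second moment 1 and the third moment -1 of the deviation.\<close>

lemma lead_odd:
  "real (Suc K) * lead (Suc (Suc (Suc (2 * K)))) =
     real (Suc (Suc (Suc (2 * K)))) * lead (Suc (Suc (2 * K))) * real (Suc K)
     + real (Suc (Suc (Suc (2 * K))) choose 2) * lead (Suc (2 * K))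
     - real (Suc (Suc (Suc (2 * K))) choose 3) * lead (2 * K)"
proof -
  have 1: "double_fact (Suc (2 * K)) = (2 * K + 1) * double_fact (2 * K - 1)"
    using double_fact_odd[of K] by simp
  have 2: "double_fact (Suc (Suc (Suc (2 * K)))) = (2 * K + 3) * double_fact (Suc (2 * K))"
    by (simp add: algebra_simps)
  have d: "Suc (Suc (Suc (2 * K))) div 2 = Suc K" "Suc (2 * K) div 2 = K" by simp_all
  have l: "lead (Suc (Suc (Suc (2 * K)))) = 2 / 3 * real (Suc K) * ((2 * real K + 3) * ((2 * real K + 1) * real (double_fact (2 * K - 1))))"
    "lead (Suc (Suc (2 * K))) = (2 * real K + 1) * real (double_fact (2 * K - 1))"
    "lead (Suc (2 * K)) = 2 / 3 * real K * ((2 * real K + 1) * real (double_fact (2 * K - 1)))"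
    "lead (2 * K) = real (double_fact (2 * K - 1))"
    unfolding lead_def d 2 1 by (simp_all add: 1 ring_distribs)
  show ?thesis
    unfolding l real_choose_two real_choose_three by (simp add: field_simps)
qed

text \<open>Orders below \<open>2 * K\<close> are at least two levels down and disappear in the
  error. The remaining two or three orders produce precisely the coefficient that the drift of the
  leading power has to balance.\<close>

lemma sum_terms_approx:
  assumes "m \<ge> 2" "\<And>j. j < m \<Longrightarrow> controlled j"
  shows "poly_dom (incr_rate (m div 2)) (\<lambda>n d.
     (\<Sum>j<m. real (m choose j) * Ed n (\<lambda>d. central_moment j (n - d) * eps n d ^ (m - j)))
       - real (m div 2) * lead m * real n ^ (m div 2 - 1))"
proof -
  define T where "T j n = Ed n (\<lambda>d. central_moment j (n - d) * eps n d ^ (m - j))" for j n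
  obtain K where K: "m = Suc (Suc (2 * K)) \<or> m = Suc (Suc (Suc (2 * K)))"
    using assms(1) by (metis Suc_eq_plus1 add_2_eq_Suc' even_two_times_div_two le_Suc_ex oddE add.commute)
  have M: "m div 2 = Suc K" using K by auto
  have small: "poly_dom (incr_rate (Suc K)) (\<lambda>n d. \<Sum>j<2*K. real (m choose j) * T j n)"
    unfolding T_def using assms(2) K by (intro poly_dom_sum poly_dom_cmult term_small) auto
  from K show ?thesis
  proof
    assume m: "m = Suc (Suc (2 * K))"
    have t0: "poly_dom (incr_rate (Suc K)) (\<lambda>n d. T (2 * K) n - lead (2 * K) * 1 * real n ^ K)"
      using term_approx[OF assms(2) Ed_eps_2, of "2 * K"] by (simp add: T_def m)
    \<comment> \<open>This moment may have size \<open>n ^ K\<close>, but it meets the first power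
      of \<open>eps\<close>, so its main term is 0.\<close>
    have t1: "poly_dom (incr_rate (Suc K)) (\<lambda>n d. T (Suc (2 * K)) n - lead (Suc (2 * K)) * 0 * real n ^ K)"
      using term_approx[OF assms(2) Ed_eps_1, of "Suc (2 * K)"] by (simp add: T_def m)
    have b: "m choose (2 * K) = m choose 2"
      using binomial_symmetric[of "2 * K" m] by (simp add: m)
    have le: "real (Suc K) * lead m = real (m choose 2) * lead (2 * K)"
      unfolding m by (rule lead_even)
    show ?thesis
      unfolding M T_def[symmetric]
    proof (rule poly_dom_cong[OF poly_dom_add[OF small poly_dom_add[OF poly_dom_cmult[OF t0, of "real (m choose 2)"]
          poly_dom_cmult[OF t1, of "real (m choose Suc (2 * K))"]]]])
      fix n d :: nat
      have "(\<Sum>j<m. real (m choose j) * T j n) = (\<Sum>j<2*K. real (m choose j) * T j n)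
         + real (m choose 2) * T (2 * K) n + real (m choose Suc (2 * K)) * T (Suc (2 * K)) n"
      proof -
        have "{..<m} = insert (2 * K) (insert (Suc (2 * K)) {..<2 * K})" using m by auto
        then show ?thesis by (simp add: b)
      qed
      then show "(\<Sum>j<m. real (m choose j) * T j n) - real (Suc K) * lead m * real n ^ (Suc K - 1) =
        (\<Sum>j<2*K. real (m choose j) * T j n) + (real (m choose 2) * (T (2 * K) n - lead (2 * K) * 1 * real n ^ K)
         + real (m choose Suc (2 * K)) * (T (Suc (2 * K)) n - lead (Suc (2 * K)) * 0 * real n ^ K))"
        unfolding le by (simp add: algebra_simps)
    qed
  next
    assume m: "m = Suc (Suc (Suc (2 * K)))"
    have e: "m - 2 * K = 3" "m - Suc (2 * K) = 2" "m - Suc (Suc (2 * K)) = 1" by (simp_all add: m)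
    have t0: "poly_dom (incr_rate (Suc K)) (\<lambda>n d. T (2 * K) n - lead (2 * K) * (- 1) * real n ^ K)"
      unfolding T_def e using term_approx[OF assms(2) Ed_eps_3, of "2 * K"] m by simp
    have t1: "poly_dom (incr_rate (Suc K)) (\<lambda>n d. T (Suc (2 * K)) n - lead (Suc (2 * K)) * 1 * real n ^ K)"
      unfolding T_def e using term_approx[OF assms(2) Ed_eps_2, of "Suc (2 * K)"] m by simp
    \<comment> \<open>The only term whose order lies on the level of \<open>m\<close> itself, hence
      the expansion with cancellation.\<close>
    have t2: "poly_dom (incr_rate (Suc K)) (\<lambda>n d. T (Suc (Suc (2 * K))) n
       - lead (Suc (Suc (2 * K))) * real (Suc K) * real n ^ K)"
      unfolding T_def e using term_linear[OF assms(2), of "Suc (Suc (2 * K))" K] m by simp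
    have b: "m choose (2 * K) = m choose 3" "m choose Suc (2 * K) = m choose 2" "m choose Suc (Suc (2 * K)) = m"
      using binomial_symmetric[of "2 * K" m] binomial_symmetric[of "Suc (2 * K)" m]
        binomial_symmetric[of "Suc (Suc (2 * K))" m] by (simp_all add: m numeral_eq_Suc)
    have le: "real (Suc K) * lead m = real m * lead (Suc (Suc (2 * K))) * real (Suc K)
        + real (m choose 2) * lead (Suc (2 * K)) - real (m choose 3) * lead (2 * K)"
      unfolding m by (rule lead_odd)
    show ?thesis
      unfolding M T_def[symmetric]
    proof (rule poly_dom_cong[OF poly_dom_add[OF small poly_dom_add[OF poly_dom_cmult[OF t0, of "real (m choose 3)"]
          poly_dom_add[OF poly_dom_cmult[OF t1, of "real (m choose 2)"] poly_dom_cmult[OF t2, of "real m"]]]]])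
      fix n d :: nat
      have "(\<Sum>j<m. real (m choose j) * T j n) = (\<Sum>j<2*K. real (m choose j) * T j n)
         + real (m choose 3) * T (2 * K) n + real (m choose 2) * T (Suc (2 * K)) n
         + real m * T (Suc (Suc (2 * K))) n"
      proof -
        have "{..<m} = insert (2 * K) (insert (Suc (2 * K)) (insert (Suc (Suc (2 * K))) {..<2 * K}))"
          using m by auto
        then show ?thesis by (simp add: b)
      qed
      then show "(\<Sum>j<m. real (m choose j) * T j n) - real (Suc K) * lead m * real n ^ (Suc K - 1) =
        (\<Sum>j<2*K. real (m choose j) * T j n) + (real (m choose 3) * (T (2 * K) n - lead (2 * K) * (- 1) * real n ^ K)
         + (real (m choose 2) * (T (Suc (2 * K)) n - lead (Suc (2 * K)) * 1 * real n ^ K)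
         + real m * (T (Suc (Suc (2 * K))) n - lead (Suc (Suc (2 * K))) * real (Suc K) * real n ^ K)))"
        unfolding le by (simp add: algebra_simps)
    qed
  qed
qed

text \<open>Subtracting the leading power from the first-step equation gives a recurrence for
  \<open>resid m\<close>. Its forcing is the lower-order sum minus the drift of that power; the
  coefficients cancel, and what remains is of size \<open>incr_rate M\<close>.\<close>

lemma controlled_step:
  assumes "m \<ge> 2" "\<And>j. j < m \<Longrightarrow> controlled j"
  shows "controlled m"
proof -
  define M where "M = m div 2"
  have M: "M \<ge> 1" using assms(1) by (simp add: M_def)
  define U where "U n = (\<Sum>j<m. real (m choose j) * Ed n (\<lambda>d. central_moment j (n - d) * eps n d ^ (m - j)))" for n
  let ?P = "\<lambda>n d. real (n - d) ^ M - real n ^ M + real M * real d * real n ^ (M - 1)"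
  have 1: "poly_dom (incr_rate M) (\<lambda>n d. U n - real M * lead m * real n ^ (M - 1))"
    using sum_terms_approx[OF assms] unfolding U_def M_def by simp
  have 2: "poly_dom (incr_rate M) (\<lambda>n d. Ed n (?P n))"
    by (intro poly_dom_Ed poly_dom_power_diff2)
  \<comment> \<open>This correction arises because the mean loss is \<open>1 - 1 / n\<close> and not
    1.\<close>
  have "\<bar>real n ^ (M - 1) * (1 / real n)\<bar> \<le> 1 * \<bar>incr_rate M n\<bar>" if "n \<ge> 1" for n
    using power_div_le_incr_rate[OF that, of "M - 1"] M by simp
  from poly_dom_mono[OF poly_dom_self this]
  have 3: "poly_dom (incr_rate M) (\<lambda>n d. real n ^ (M - 1) * (1 / real n))" .
  have "poly_dom (incr_rate M) (\<lambda>n d. resid m n - Ed n (\<lambda>d. resid m (n - d)))"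
  proof (rule poly_dom_fst_cong[where N = 2, OF poly_dom_add[OF 1 poly_dom_add[OF
        poly_dom_cmult[OF 2, of "lead m"] poly_dom_cmult[OF 3, of "lead m * real M"]]]])
    fix n :: nat assume n: "n \<ge> 2" "n \<ge> 1"
    have "central_moment m n = (\<Sum>j\<le>m. real (m choose j) * Ed n (\<lambda>d. central_moment j (n - d) * eps n d ^ (m - j)))"
      unfolding central_moment_step[OF n(1), of m] Ed_sum eps_def mult.assoc Ed_cmult ..
    also have "\<dots> = U n + Ed n (\<lambda>d. central_moment m (n - d))"
      by (simp add: U_def flip: lessThan_Suc_atMost)
    finally have c: "central_moment m n = U n + Ed n (\<lambda>d. central_moment m (n - d))" .
    have p: "Ed n (?P n) = Ed n (\<lambda>d. real (n - d) ^ M) - real n ^ M + real M * (1 - 1 / real n) * real n ^ (M - 1)"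
      unfolding Ed_add Ed_diff Ed_multc Ed_cmult Ed_const Ed_id[OF n(2)] ..
    have r: "Ed n (\<lambda>d. resid m (n - d)) = Ed n (\<lambda>d. central_moment m (n - d)) - lead m * Ed n (\<lambda>d. real (n - d) ^ M)"
      unfolding resid_def Ed_diff Ed_cmult M_def ..
    show "resid m n - Ed n (\<lambda>d. resid m (n - d)) = (U n - real M * lead m * real n ^ (M - 1)) +
       (lead m * Ed n (?P n) + lead m * real M * (real n ^ (M - 1) * (1 / real n)))"
      unfolding r p unfolding resid_def c M_def[symmetric] by (simp add: algebra_simps)
  qed (use incr_rate_pos[OF M] in \<open>simp add: less_imp_neq[THEN not_sym]\<close>)
  then have l: "lip (incr_rate M) (resid m)"
    by (intro lip_of_recurrence rate_incr_rate incr_rate_pos M)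
  have "poly_dom (err_rate M) (\<lambda>n d. resid m n)"
  proof (rule poly_dom_of_lip[OF l])
    fix n :: nat assume n: "n \<ge> 2"
    show "0 \<le> incr_rate M n" using rateD(1)[OF rate_incr_rate] n by simp
    have lnm: "ln (real (n - 1)) \<le> ln (real n)" using n by simp
    show "incr_rate M n \<le> err_rate M n - err_rate M (n - 1)"
    proof (cases "(M, n)" rule: incr_rate.cases)
      case (2 n')
      \<comment> \<open>At the lowest level the increments \<open>1 / n\<close> are summed to a
        logarithm, since \<open>1 / n \<le> ln n - ln (n - 1)\<close>.\<close>
      have "ln (real (n - 1) / real n) \<le> real (n - 1) / real n - 1"
        using n by (intro ln_le_minus_one) auto
      moreover have "ln (real (n - 1) / real n) = ln (real (n - 1)) - ln (real n)"
        using n by (simp add: ln_div)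
      moreover have "real (n - 1) / real n - 1 = - (1 / real n)"
        using n by (simp add: of_nat_diff field_simps)
      ultimately show ?thesis using 2 by simp
    next
      case (3 K n')
      \<comment> \<open>Replacing all but one factor \<open>n - 1\<close> by \<open>n\<close> leaves
        a gap of exactly \<open>n ^ K * (1 + ln n)\<close>, the increment scale.\<close>
      have "real (n - 1) ^ Suc K * (1 + ln (real (n - 1))) \<le> (real (n - 1) * real n ^ K) * (1 + ln (real n))"
        using n lnm by (intro mult_mono) (auto intro!: mult_left_mono power_mono mult_nonneg_nonneg)
      also have "\<dots> = real n ^ Suc K * (1 + ln (real n)) - real n ^ K * (1 + ln (real n))"
        using n by (simp add: of_nat_diff algebra_simps)
      finally show ?thesis using 3 by simp
    qed (use M in auto)
  qed (use M in \<open>cases M; simp\<close>)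
  with l show ?thesis by (simp add: controlled_def M_def)
qed

lemma controlled: "controlled m"
proof (induction m rule: less_induct)
  case (less m)
  show ?case
  proof (cases "m \<ge> 2")
    case True
    then show ?thesis using controlled_step less by blast
  next
    case False
    \<comment> \<open>For these orders the leading term is the whole moment, so the residual is 0,
      in accordance with the zero scales at level 0.\<close>
    then have "m = 0 \<or> m = Suc 0" by auto
    then have "resid m n = 0" if "n \<ge> 1" for n
      using that central_moment_1[of n] by (auto simp: resid_def lead_def)
    then show ?thesis
      unfolding controlled_def lip_def poly_dom_def by (auto intro!: exI[of _ 0])
  qed
qed

lemma resid_bigo:
  assumes "M = m div 2" "M \<ge> 1"
  shows "resid m \<in> O(\<lambda>n. real n ^ (M - 1) * ln (real n))"
proof -
  have "poly_dom (err_rate M) (\<lambda>n d. resid m n)"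
    using controlled[of m] unfolding controlled_def assms(1) by simp
  then obtain C where C: "\<And>n. n \<ge> 1 \<Longrightarrow> \<bar>resid m n\<bar> \<le> C * \<bar>err_rate M n\<bar>"
    unfolding poly_dom_fst_iff by blast
  obtain K where K: "M = Suc K" using assms(2) by (cases M) auto
  show ?thesis
  proof (rule bigoI[of _ "2 * \<bar>C\<bar>"], rule eventually_sequentiallyI[of 3])
    fix n :: nat assume n: "n \<ge> 3"
    \<comment> \<open>From \<open>n = 3\<close> on the logarithm is at least 1, so
      \<open>1 + ln n\<close> is at most \<open>2 * ln n\<close>.\<close>
    have "exp 1 \<le> real n" using exp_le n by linarith
    then have ln: "ln (real n) \<ge> 1" using n by (simp add: ln_ge_iff)
    have "\<bar>resid m n\<bar> \<le> C * \<bar>err_rate M n\<bar>" using C n by simp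
    also have "\<dots> \<le> \<bar>C\<bar> * \<bar>err_rate M n\<bar>" by (intro mult_right_mono) auto
    also have "\<dots> \<le> \<bar>C\<bar> * (real n ^ K * (2 * ln (real n)))"
      using ln by (auto simp: K abs_mult intro!: mult_left_mono)
    finally show "norm (resid m n) \<le> 2 * \<bar>C\<bar> * norm (real n ^ (M - 1) * ln (real n))"
      using ln by (simp add: K abs_mult mult_ac)
  qed
qed

theorem theorem1p2:
  fixes m :: nat
  assumes "m \<ge> 2"
  shows "\<forall>M. (m = 2 * M \<longrightarrow>
            (\<lambda>n. central_moment m n - real (double_fact (2 * M - 1)) * real n ^ M)
              \<in> O(\<lambda>n. real n ^ (M - 1) * ln (real n))) \<and>
           (m = 2 * M + 1 \<longrightarrow>
            (\<lambda>n. central_moment m n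
                   - 2 / 3 * real M * real (double_fact (2 * M + 1)) * real n ^ M)
              \<in> O(\<lambda>n. real n ^ (M - 1) * ln (real n)))"
proof (intro allI conjI impI)
  fix M assume "m = 2 * M"
  then show "(\<lambda>n. central_moment m n - real (double_fact (2 * M - 1)) * real n ^ M)
              \<in> O(\<lambda>n. real n ^ (M - 1) * ln (real n))"
    using resid_bigo[of M m] assms by (simp add: resid_def[abs_def] lead_def)
next
  fix M assume "m = 2 * M + 1"
  then show "(\<lambda>n. central_moment m n
                   - 2 / 3 * real M * real (double_fact (2 * M + 1)) * real n ^ M)
              \<in> O(\<lambda>n. real n ^ (M - 1) * ln (real n))"
    using resid_bigo[of M m] assms by (simp add: resid_def[abs_def] lead_def)
qed

end
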